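(* Let $R$ be a finite Frobenius local ring with unity (not assumed commutative). Let $C$ and $D$ be two free linear codes in $R^n$ (i.e. right $R$-submodules of $R^n$ that are free as right $R$-modules) with generator matrices $\mathrm{G}_1,\mathrm{G}_2$ and parity check matrices $\mathrm{H}_1,\mathrm{H}_2$ respectively, and suppose $|C||D|=|R^n|$. Then the pair $(C,D)$ is LCP if and only if $\mathrm{H}_2\mathrm{G}_1^\top$ or $\mathrm{H}_1\mathrm{G}_2^\top$ is invertible.
   Context: A ring is local if its non-units form an additive abelian group; for a finite local ring $R$, the Jacobson radical $J(R)$ is the set of non-units and $R/J(R)=\mathbb{F}_q$ is a finite field; $\pi:R\to\mathbb{F}_q$ denotes the quotient map, applied entrywise to vectors and matrices. A finite ring $R$ is Frobenius if it is right and left self-injective and $R/J(R)\cong \mathrm{Soc}(R)$ as right $R$-modules. A linear code of length $n$ over $R$ is a right $R$-submodule of $R^n$. A right $R$-module is free if it is isomorphic to $R^t$ for some integer $t\ge 0$. The pair $(C,D)$ is LCP (a linear complementary pair) if $C\oplus D=R^n$, i.e. $C+D=R^n$ and $C\cap D=\{0\}$. For $x,y\in R^n$ put $[x,y]=\sum_{i=1}^n x_iy_i$, and $C^\perp=\{v\in R^n : [v,c]=0\ \forall c\in C\}$, a left $R$-submodule of $R^n$. A generator matrix of $C$ is a matrix $\mathrm{G}$ whose rows form a minimal generating set of the right $R$-module $C$, so that (identifying rows with columns) $C=\{\mathrm{G}^\top\alpha^\top:\alpha\in R^k\}$. A parity check matrix of $C$ is a matrix $\mathrm{H}$ whose rows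 form a minimal generating set of the left $R$-module $C^\perp$. A square matrix $\mathrm{A}=(a_{ij})$ over $R$ is called invertible over $R$ if $\pi(\mathrm{A})=(\pi(a_{ij}))$ is invertible over $\mathbb{F}_q$. *)

theory Defs
  imports "HOL-Algebra.Algebraic_Closure_Type" "Jordan_Normal_Form.Matrix"
begin

section \<open>Modules over a not necessarily commutative ring\<close>

text \<open>
  The locale \<^locale>\<open>module\<close> of HOL-Algebra requires a commutative ring of scalars. Left and right
  modules are stored in the same record type, whose multiplication and unit are irrelevant. In a
  right module \<open>r \<odot>\<^bsub>M\<^esub> x\<close> stands for \<open>x r\<close>; hence the order of the scalars in the last axiom.
  Linear maps, submodules (the library's \<^const>\<open>submodule\<close>, which makes no use of commutativity) and
  quotients are the same notions for left and for right modules.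
\<close>

locale left_module = R: ring R + M: abelian_group M
  for R :: "('a, 'c) ring_scheme" and M :: "('a, 'm, 'd) module_scheme" +
  assumes act_closed: "\<lbrakk>r \<in> carrier R; x \<in> carrier M\<rbrakk> \<Longrightarrow> r \<odot>\<^bsub>M\<^esub> x \<in> carrier M"
    and act_add_scalar: "\<lbrakk>r \<in> carrier R; s \<in> carrier R; x \<in> carrier M\<rbrakk>
      \<Longrightarrow> (r \<oplus>\<^bsub>R\<^esub> s) \<odot>\<^bsub>M\<^esub> x = (r \<odot>\<^bsub>M\<^esub> x) \<oplus>\<^bsub>M\<^esub> (s \<odot>\<^bsub>M\<^esub> x)"
    and act_add_vector: "\<lbrakk>r \<in> carrier R; x \<in> carrier M; y \<in> carrier M\<rbrakk>
      \<Longrightarrow> r \<odot>\<^bsub>M\<^esub> (x \<oplus>\<^bsub>M\<^esub> y) = (r \<odot>\<^bsub>M\<^esub> x) \<oplus>\<^bsub>M\<^esub> (r \<odot>\<^bsub>M\<^esub> y)"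
    and act_one: "x \<in> carrier M \<Longrightarrow> \<one>\<^bsub>R\<^esub> \<odot>\<^bsub>M\<^esub> x = x"
    and act_assoc: "\<lbrakk>r \<in> carrier R; s \<in> carrier R; x \<in> carrier M\<rbrakk>
      \<Longrightarrow> (r \<otimes>\<^bsub>R\<^esub> s) \<odot>\<^bsub>M\<^esub> x = r \<odot>\<^bsub>M\<^esub> (s \<odot>\<^bsub>M\<^esub> x)"

locale right_module = R: ring R + M: abelian_group M
  for R :: "('a, 'c) ring_scheme" and M :: "('a, 'm, 'd) module_scheme" +
  assumes act_closed: "\<lbrakk>r \<in> carrier R; x \<in> carrier M\<rbrakk> \<Longrightarrow> r \<odot>\<^bsub>M\<^esub> x \<in> carrier M"
    and act_add_scalar: "\<lbrakk>r \<in> carrier R; s \<in> carrier R; x \<in> carrier M\<rbrakk>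
      \<Longrightarrow> (r \<oplus>\<^bsub>R\<^esub> s) \<odot>\<^bsub>M\<^esub> x = (r \<odot>\<^bsub>M\<^esub> x) \<oplus>\<^bsub>M\<^esub> (s \<odot>\<^bsub>M\<^esub> x)"
    and act_add_vector: "\<lbrakk>r \<in> carrier R; x \<in> carrier M; y \<in> carrier M\<rbrakk>
      \<Longrightarrow> r \<odot>\<^bsub>M\<^esub> (x \<oplus>\<^bsub>M\<^esub> y) = (r \<odot>\<^bsub>M\<^esub> x) \<oplus>\<^bsub>M\<^esub> (r \<odot>\<^bsub>M\<^esub> y)"
    and act_one: "x \<in> carrier M \<Longrightarrow> \<one>\<^bsub>R\<^esub> \<odot>\<^bsub>M\<^esub> x = x"
    and act_assoc: "\<lbrakk>r \<in> carrier R; s \<in> carrier R; x \<in> carrier M\<rbrakk>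
      \<Longrightarrow> (r \<otimes>\<^bsub>R\<^esub> s) \<odot>\<^bsub>M\<^esub> x = s \<odot>\<^bsub>M\<^esub> (r \<odot>\<^bsub>M\<^esub> x)"

definition left_regular :: "('a, 'c) ring_scheme \<Rightarrow> ('a, 'a) module" where
  "left_regular R = \<lparr>carrier = carrier R, monoid.mult = undefined, one = undefined,
     zero = \<zero>\<^bsub>R\<^esub>, add = add R, module.smult = (\<lambda>r x. r \<otimes>\<^bsub>R\<^esub> x)\<rparr>"

definition right_regular :: "('a, 'c) ring_scheme \<Rightarrow> ('a, 'a) module" where
  "right_regular R = \<lparr>carrier = carrier R, monoid.mult = undefined, one = undefined,
     zero = \<zero>\<^bsub>R\<^esub>, add = add R, module.smult = (\<lambda>r x. x \<otimes>\<^bsub>R\<^esub> r)\<rparr>"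

definition module_homs ::
  "('a, 'c) ring_scheme \<Rightarrow> ('a, 'm, 'd) module_scheme \<Rightarrow> ('a, 'n, 'e) module_scheme \<Rightarrow> ('m \<Rightarrow> 'n) set"
  where "module_homs R M N = {f \<in> carrier M \<rightarrow> carrier N.
     (\<forall>x\<in>carrier M. \<forall>y\<in>carrier M. f (x \<oplus>\<^bsub>M\<^esub> y) = f x \<oplus>\<^bsub>N\<^esub> f y) \<and>
     (\<forall>r\<in>carrier R. \<forall>x\<in>carrier M. f (r \<odot>\<^bsub>M\<^esub> x) = r \<odot>\<^bsub>N\<^esub> f x)}"

definition module_isomorphic ::
  "('a, 'c) ring_scheme \<Rightarrow> ('a, 'm, 'd) module_scheme \<Rightarrow> ('a, 'n, 'e) module_scheme \<Rightarrow> bool"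
  where "module_isomorphic R M N \<longleftrightarrow>
     (\<exists>f \<in> module_homs R M N. bij_betw f (carrier M) (carrier N))"

definition quotient_module :: "('a, 'm, 'd) module_scheme \<Rightarrow> 'm set \<Rightarrow> ('a, 'm set) module" where
  "quotient_module M N = \<lparr>carrier = a_rcosets\<^bsub>M\<^esub> N, monoid.mult = undefined, one = undefined,
     zero = N, add = set_add M, module.smult = (\<lambda>r K. \<Union>x\<in>K. N +>\<^bsub>M\<^esub> (r \<odot>\<^bsub>M\<^esub> x))\<rparr>"

definition module_span ::
  "('a, 'c) ring_scheme \<Rightarrow> ('a, 'm, 'd) module_scheme \<Rightarrow> 'm set \<Rightarrow> 'm set" where
  "module_span R M S = (\<lambda>N. submodule N R M) hull S"

definition minimal_generating_set ::
  "('a, 'c) ring_scheme \<Rightarrow> ('a, 'm, 'd) module_scheme \<Rightarrow> 'm set \<Rightarrow> 'm set \<Rightarrow> bool" where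
  "minimal_generating_set R M C S \<longleftrightarrow>
     module_span R M S = C \<and> (\<forall>T. T \<subset> S \<longrightarrow> module_span R M T \<noteq> C)"

text \<open>
  A definition cannot quantify over all types, so the test modules \<open>A\<close> and \<open>B\<close> below are those with
  elements of type \<^typ>\<open>nat \<Rightarrow> 'a\<close>. Up to isomorphism these include \<open>R\<close>, its one-sided ideals, and
  every module of at most the cardinality of \<^typ>\<open>nat \<Rightarrow> 'a\<close>. By Baer's criterion extending
  homomorphisms from the one-sided ideals to \<open>R\<close> is enough, so nothing is lost.
\<close>

definition left_injective ::
  "('a, 'c) ring_scheme \<Rightarrow> ('a, 'm, 'd) module_scheme \<Rightarrow> bool" where
  "left_injective R E \<longleftrightarrow>
     (\<forall>(A :: ('a, nat \<Rightarrow> 'a) module) (B :: ('a, nat \<Rightarrow> 'a) module).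
        left_module R A \<longrightarrow> left_module R B \<longrightarrow>
        (\<forall>i \<in> module_homs R A B. inj_on i (carrier A) \<longrightarrow>
           (\<forall>f \<in> module_homs R A E. \<exists>g \<in> module_homs R B E. \<forall>x\<in>carrier A. g (i x) = f x)))"

definition right_injective ::
  "('a, 'c) ring_scheme \<Rightarrow> ('a, 'm, 'd) module_scheme \<Rightarrow> bool" where
  "right_injective R E \<longleftrightarrow>
     (\<forall>(A :: ('a, nat \<Rightarrow> 'a) module) (B :: ('a, nat \<Rightarrow> 'a) module).
        right_module R A \<longrightarrow> right_module R B \<longrightarrow>
        (\<forall>i \<in> module_homs R A B. inj_on i (carrier A) \<longrightarrow>
           (\<forall>f \<in> module_homs R A E. \<exists>g \<in> module_homs R B E. \<forall>x\<in>carrier A. g (i x) = f x)))"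


section \<open>Local rings, Frobenius rings, the residue field\<close>

definition maximal_submodule ::
  "('a, 'c) ring_scheme \<Rightarrow> ('a, 'm, 'd) module_scheme \<Rightarrow> 'm set \<Rightarrow> bool" where
  "maximal_submodule R M N \<longleftrightarrow> submodule N R M \<and> N \<noteq> carrier M \<and>
     (\<forall>L. submodule L R M \<longrightarrow> N \<subseteq> L \<longrightarrow> L = N \<or> L = carrier M)"

definition minimal_submodule ::
  "('a, 'c) ring_scheme \<Rightarrow> ('a, 'm, 'd) module_scheme \<Rightarrow> 'm set \<Rightarrow> bool" where
  "minimal_submodule R M N \<longleftrightarrow> submodule N R M \<and> N \<noteq> {\<zero>\<^bsub>M\<^esub>} \<and>
     (\<forall>L. submodule L R M \<longrightarrow> L \<subseteq> N \<longrightarrow> L = {\<zero>\<^bsub>M\<^esub>} \<or> L = N)"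

definition jacobson_radical :: "('a, 'c) ring_scheme \<Rightarrow> 'a set" where
  "jacobson_radical R = carrier R \<inter> \<Inter>{N. maximal_submodule R (right_regular R) N}"

definition right_socle :: "('a, 'c) ring_scheme \<Rightarrow> 'a set" where
  "right_socle R =
     module_span R (right_regular R) (\<Union>{N. minimal_submodule R (right_regular R) N})"

definition local_ring :: "('a, 'c) ring_scheme \<Rightarrow> bool" where
  "local_ring R \<longleftrightarrow> ring R \<and> subgroup (carrier R - Units R) (add_monoid R)"

definition finite_frobenius_ring :: "('a, 'c) ring_scheme \<Rightarrow> bool" where
  "finite_frobenius_ring R \<longleftrightarrow> ring R \<and> finite (carrier R) \<and>
     right_injective R (right_regular R) \<and> left_injective R (left_regular R) \<and>
     module_isomorphic R (quotient_module (right_regular R) (jacobson_radical R))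
       ((right_regular R)\<lparr>carrier := right_socle R\<rparr>)"

definition residue_field :: "('a, 'c) ring_scheme \<Rightarrow> 'a set ring" where
  "residue_field R = R Quot jacobson_radical R"

definition residue_map :: "('a, 'c) ring_scheme \<Rightarrow> 'a \<Rightarrow> 'a set" where
  "residue_map R x = jacobson_radical R +>\<^bsub>R\<^esub> x"

lemma right_module_right_regular:
  assumes "ring R" shows "right_module R (right_regular R)"
proof -
  interpret R: ring R by (rule assms)
  have "abelian_group (right_regular R)"
  proof (rule abelian_groupI)
    fix x assume "x \<in> carrier (right_regular R)"
    then show "\<exists>y\<in>carrier (right_regular R).
        y \<oplus>\<^bsub>right_regular R\<^esub> x = \<zero>\<^bsub>right_regular R\<^esub>"
      by (intro bexI[of _ "\<ominus>\<^bsub>R\<^esub> x"]) (auto simp: right_regular_def R.l_neg)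
  qed (auto simp: right_regular_def R.a_ac)
  then show ?thesis
    by (intro right_module.intro right_module_axioms.intro assms)
       (auto simp: right_regular_def R.l_distr R.r_distr R.m_assoc)
qed

lemma left_module_left_regular:
  assumes "ring R" shows "left_module R (left_regular R)"
proof -
  interpret R: ring R by (rule assms)
  have "abelian_group (left_regular R)"
  proof (rule abelian_groupI)
    fix x assume "x \<in> carrier (left_regular R)"
    then show "\<exists>y\<in>carrier (left_regular R).
        y \<oplus>\<^bsub>left_regular R\<^esub> x = \<zero>\<^bsub>left_regular R\<^esub>"
      by (intro bexI[of _ "\<ominus>\<^bsub>R\<^esub> x"]) (auto simp: left_regular_def R.l_neg)
  qed (auto simp: left_regular_def R.a_ac)
  then show ?thesis
    by (intro left_module.intro left_module_axioms.intro assms)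
       (auto simp: left_regular_def R.l_distr R.r_distr R.m_assoc)
qed

lemma (in ring) finite_left_inv_imp_Units:
  assumes fin: "finite (carrier R)" and a: "a \<in> carrier R" and b: "b \<in> carrier R"
    and ba: "b \<otimes> a = \<one>"
  shows "a \<in> Units R \<and> b \<in> Units R"
proof -
  have "inj_on (\<lambda>x. a \<otimes> x) (carrier R)"
  proof (rule inj_onI)
    fix x y assume xy: "x \<in> carrier R" "y \<in> carrier R" "a \<otimes> x = a \<otimes> y"
    then have "b \<otimes> (a \<otimes> x) = b \<otimes> (a \<otimes> y)" by simp
    then show "x = y" using xy a b ba by (metis l_one m_assoc)
  qed
  then have "(\<lambda>x. a \<otimes> x) ` carrier R = carrier R"
    using fin a by (intro endo_inj_surj) auto
  then obtain c where c: "c \<in> carrier R" "a \<otimes> c = \<one>"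
    by (metis imageE one_closed)
  then have "b = c" using a b ba by (metis m_assoc l_one r_one)
  then show ?thesis using a b ba c unfolding Units_def by auto
qed

lemma jacobson_radical_eq_nonunits:
  assumes loc: "local_ring R" and fin: "finite (carrier R)"
  shows "jacobson_radical R = carrier R - Units R"
proof -
  let ?M = "right_regular R" and ?N = "carrier R - Units R"
  interpret R: ring R using loc unfolding local_ring_def by simp
  have sg: "subgroup ?N (add_monoid R)" using loc unfolding local_ring_def by simp
  have add_eq: "subgroup H (add_monoid ?M) \<longleftrightarrow> subgroup H (add_monoid R)" for H
    by (simp add: subgroup_def right_regular_def m_inv_def)
  have sub_iff: "submodule H R ?M \<longleftrightarrow>
      subgroup H (add_monoid R) \<and> (\<forall>r\<in>carrier R. \<forall>x\<in>H. x \<otimes>\<^bsub>R\<^esub> r \<in> H)" for H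
    unfolding submodule_def submodule_axioms_def add_eq by (auto simp: right_regular_def)
  have "x \<otimes>\<^bsub>R\<^esub> r \<notin> Units R" if x: "x \<in> ?N" and r: "r \<in> carrier R" for x r
  proof
    assume u: "x \<otimes>\<^bsub>R\<^esub> r \<in> Units R"
    define v where "v = inv\<^bsub>R\<^esub> (x \<otimes>\<^bsub>R\<^esub> r)"
    have v: "v \<in> carrier R" "x \<otimes>\<^bsub>R\<^esub> (r \<otimes>\<^bsub>R\<^esub> v) = \<one>\<^bsub>R\<^esub>"
      using u x r R.Units_r_inv[OF u] R.Units_inv_closed[OF u] R.m_assoc[of x r v]
      unfolding v_def by auto
    then show False
      using R.finite_left_inv_imp_Units[OF fin, of "r \<otimes>\<^bsub>R\<^esub> v" x] x r by auto
  qed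
  then have N: "submodule ?N R ?M" using sg unfolding sub_iff by auto
  have "\<one>\<^bsub>R\<^esub> \<notin> ?N" by auto
  then have proper: "?N \<noteq> carrier ?M" by (auto simp: right_regular_def)
  have small: "H \<subseteq> ?N" if H: "submodule H R ?M" "H \<noteq> carrier ?M" for H
  proof
    fix x assume x: "x \<in> H"
    have Hc: "H \<subseteq> carrier R"
      using H(1) subgroup.subset[of H "add_monoid R"] unfolding sub_iff by auto
    have "x \<notin> Units R"
    proof
      assume "x \<in> Units R"
      then have "x \<otimes>\<^bsub>R\<^esub> (inv\<^bsub>R\<^esub> x \<otimes>\<^bsub>R\<^esub> r) = r" if "r \<in> carrier R" for r
        using that by (metis R.Units_closed R.Units_inv_closed R.Units_r_inv R.l_one R.m_assoc)
      then have "carrier R \<subseteq> H"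
        using H(1) x \<open>x \<in> Units R\<close> unfolding sub_iff by (metis R.Units_inv_closed R.m_closed subsetI)
      then show False using H(2) Hc by (auto simp: right_regular_def)
    qed
    then show "x \<in> ?N" using x Hc by auto
  qed
  have "maximal_submodule R ?M H \<longleftrightarrow> H = ?N" for H
    unfolding maximal_submodule_def using N proper small by (metis subset_antisym)
  then show ?thesis unfolding jacobson_radical_def by auto
qed


section \<open>Invertible matrices\<close>

definition mats_over :: "('a, 'c) ring_scheme \<Rightarrow> nat \<Rightarrow> nat \<Rightarrow> 'a mat set" where
  "mats_over F m n = {A \<in> carrier_mat m n. elements_mat A \<subseteq> carrier F}"

definition mat_prod_over :: "('a, 'c) ring_scheme \<Rightarrow> 'a mat \<Rightarrow> 'a mat \<Rightarrow> 'a mat" where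
  "mat_prod_over F A B = mat (dim_row A) (dim_col B)
     (\<lambda>(i, j). \<Oplus>\<^bsub>F\<^esub>l\<in>{..<dim_col A}. A $$ (i, l) \<otimes>\<^bsub>F\<^esub> B $$ (l, j))"

definition one_mat_over :: "('a, 'c) ring_scheme \<Rightarrow> nat \<Rightarrow> 'a mat" where
  "one_mat_over F k = mat k k (\<lambda>(i, j). if i = j then \<one>\<^bsub>F\<^esub> else \<zero>\<^bsub>F\<^esub>)"

definition invertible_mat_over :: "('a, 'c) ring_scheme \<Rightarrow> 'a mat \<Rightarrow> bool" where
  "invertible_mat_over F A \<longleftrightarrow> (\<exists>k. A \<in> mats_over F k k \<and> (\<exists>B \<in> mats_over F k k.
     mat_prod_over F A B = one_mat_over F k \<and> mat_prod_over F B A = one_mat_over F k))"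

text \<open>
  From here on the ring is the type \<^typ>\<open>'a\<close>, regarded as a ring record by
  \<^const>\<open>ring_of_type_algebra\<close>.
\<close>

definition invertible_over_ring :: "'a::ring_1 mat \<Rightarrow> bool" where
  "invertible_over_ring A \<longleftrightarrow> square_mat A \<and>
     invertible_mat_over (residue_field ring_of_type_algebra)
       (map_mat (residue_map ring_of_type_algebra) A)"

lemma ring_ring_of_type_algebra: "ring (ring_of_type_algebra :: 'a::ring_1 ring)"
proof (rule ringI)
  show "abelian_group (ring_of_type_algebra :: 'a ring)"
    by (rule abelian_groupI)
       (auto simp: ring_of_type_algebra_def algebra_simps intro: exI[of _ "- x" for x] left_minus)
  show "Group.monoid (ring_of_type_algebra :: 'a ring)"
    by (rule Group.monoidI) (auto simp: ring_of_type_algebra_def algebra_simps)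
qed (auto simp: ring_of_type_algebra_def algebra_simps)


section \<open>Linear codes\<close>

text \<open>
  The library's \<^const>\<open>module_vec\<close>, with scalars acting by multiplication from the left, is \<open>R\<^sup>n\<close>
  as a left module.
\<close>

definition right_module_vec :: "'a::ring_1 itself \<Rightarrow> nat \<Rightarrow> ('a, 'a vec) module" where
  "right_module_vec ty n = (module_vec ty n)\<lparr>module.smult := (\<lambda>r. map_vec (\<lambda>x. x * r))\<rparr>"

definition linear_code :: "nat \<Rightarrow> 'a::ring_1 vec set \<Rightarrow> bool" where
  "linear_code n C \<longleftrightarrow> submodule C ring_of_type_algebra (right_module_vec TYPE('a) n)"

definition free_right_module :: "('a::ring_1, 'm) module \<Rightarrow> bool" where
  "free_right_module M \<longleftrightarrow>
     (\<exists>t. module_isomorphic ring_of_type_algebra M (right_module_vec TYPE('a) t))"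

definition free_linear_code :: "nat \<Rightarrow> 'a::ring_1 vec set \<Rightarrow> bool" where
  "free_linear_code n C \<longleftrightarrow> linear_code n C \<and>
     free_right_module ((right_module_vec TYPE('a) n)\<lparr>carrier := C\<rparr>)"

definition dual_code :: "nat \<Rightarrow> 'a::ring_1 vec set \<Rightarrow> 'a vec set" where
  "dual_code n C = {v \<in> carrier_vec n. \<forall>c\<in>C. v \<bullet> c = 0}"

text \<open>
  The rows form a minimal generating family; a repeated row would be redundant, which the set of
  rows alone does not detect.
\<close>

definition generator_matrix :: "nat \<Rightarrow> 'a::ring_1 vec set \<Rightarrow> 'a mat \<Rightarrow> bool" where
  "generator_matrix n C G \<longleftrightarrow> dim_col G = n \<and> distinct (rows G) \<and>
     minimal_generating_set ring_of_type_algebra (right_module_vec TYPE('a) n) C (set (rows G))"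

definition parity_check_matrix :: "nat \<Rightarrow> 'a::ring_1 vec set \<Rightarrow> 'a mat \<Rightarrow> bool" where
  "parity_check_matrix n C H \<longleftrightarrow> dim_col H = n \<and> distinct (rows H) \<and>
     minimal_generating_set ring_of_type_algebra (module_vec TYPE('a) n)
       (dual_code n C) (set (rows H))"

definition LCP :: "nat \<Rightarrow> 'a::ring_1 vec set \<Rightarrow> 'a vec set \<Rightarrow> bool" where
  "LCP n C D \<longleftrightarrow> {c + d | c d. c \<in> C \<and> d \<in> D} = carrier_vec n \<and> C \<inter> D = {0\<^sub>v n}"

lemma abelian_group_module_vec: "abelian_group (module_vec TYPE('a::ring_1) n)"
proof (rule abelian_groupI)
  fix x assume "x \<in> carrier (module_vec TYPE('a) n)"
  then show "\<exists>y\<in>carrier (module_vec TYPE('a) n).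
      y \<oplus>\<^bsub>module_vec TYPE('a) n\<^esub> x = \<zero>\<^bsub>module_vec TYPE('a) n\<^esub>"
    by (intro bexI[of _ "- x"]) (auto simp: module_vec_simps)
qed (auto simp: module_vec_simps intro: assoc_add_vec comm_add_vec)

lemma left_module_module_vec:
  "left_module (ring_of_type_algebra :: 'a::ring_1 ring) (module_vec TYPE('a) n)"
  by (intro left_module.intro left_module_axioms.intro ring_ring_of_type_algebra
        abelian_group_module_vec)
     (auto simp: module_vec_simps ring_of_type_algebra_def algebra_simps intro!: eq_vecI)

lemma right_module_right_module_vec:
  "right_module (ring_of_type_algebra :: 'a::ring_1 ring) (right_module_vec TYPE('a) n)"
proof -
  have "abelian_group (right_module_vec TYPE('a) n)"
    using abelian_group_module_vec[where 'a = 'a and n = n]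
    unfolding abelian_group_def abelian_group_axioms_def abelian_monoid_def right_module_vec_def
    by (simp add: module_vec_def)
  then show ?thesis
    by (intro right_module.intro right_module_axioms.intro ring_ring_of_type_algebra)
       (auto simp: right_module_vec_def module_vec_def ring_of_type_algebra_def algebra_simps
             intro!: eq_vecI)
qed

end

theory Submission
  imports Defs
begin

text \<open>
  A minimal generating family of a module over a local ring has only relations with coefficients in
  the radical, and a square matrix that is the identity modulo the radical is injective on columns.
  Hence the columns of \<open>G\<^sup>T\<close> form a basis of the free code \<open>C\<close>. Self-injectivity yields a matrix \<open>L\<close>
  with \<open>L G\<^sup>T = 1\<close>, so \<open>C\<close> is the kernel of the idempotent \<open>E = 1 - G\<^sup>T L\<close> and its dual is the row space
  of \<open>E\<close>; writing \<open>E = B H\<close> one finds \<open>H B = 1\<close>, so that \<open>C\<close> is the kernel of \<open>H\<close> and the numbers of rows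
  of \<open>G\<close> and \<open>H\<close> add up to \<open>n\<close>. By counting, the pair is complementary iff \<open>C \<inter> D = 0\<close>, that is iff the
  square matrix \<open>H\<^sub>2 G\<^sub>1\<^sup>T\<close> is injective, and over a finite local ring this means invertible modulo
  the radical.
\<close>

no_notation fps_nth (infixl "$" 75)

section \<open>Nonunits of a finite local ring\<close>

text \<open>For a finite local ring this is the Jacobson radical, by
  \<open>jacobson_radical_ring_of_type_algebra\<close>; the explicit form gives inverses without
  passing through ring records.\<close>

definition nonunits :: "'a::ring_1 set" where
  "nonunits = {x. \<not> (\<exists>y. x * y = 1 \<and> y * x = 1)}"

lemma ring_of_type_algebra_simps [simp]:
  "carrier (ring_of_type_algebra :: 'a::ring_1 ring) = UNIV"
  "monoid.mult (ring_of_type_algebra :: 'a ring) = (*)"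
  "one (ring_of_type_algebra :: 'a ring) = 1"
  "zero (ring_of_type_algebra :: 'a ring) = 0"
  "add (ring_of_type_algebra :: 'a ring) = (+)"
  by (simp_all add: ring_of_type_algebra_def)

lemma jacobson_radical_ring_of_type_algebra:
  assumes "local_ring (ring_of_type_algebra :: 'a::{finite, ring_1} ring)"
  shows "jacobson_radical (ring_of_type_algebra :: 'a ring) = nonunits"
  using jacobson_radical_eq_nonunits[OF assms] by (auto simp: Units_def nonunits_def)

text \<open>Left multiplication by \<open>a\<close> is injective, hence onto by finiteness, so
  \<open>a\<close> has a right inverse, and this must agree with \<open>b\<close>.\<close>

lemma left_inverse_imp_right_inverse:
  fixes a b :: "'a::{finite, ring_1}"
  assumes "b * a = 1"
  shows "a * b = 1"
proof -
  have "inj (\<lambda>x. a * x)"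
    by (rule inj_on_inverseI[of _ "\<lambda>x. b * x"]) (simp add: assms flip: mult.assoc)
  then have "surj (\<lambda>x. a * x)" by (rule finite_UNIV_inj_surj[OF finite_UNIV])
  then obtain c where "1 = a * c" by (rule surjE)
  moreover have "b = c"
    using arg_cong[OF \<open>1 = a * c\<close>, of "\<lambda>x. b * x"] assms by (simp flip: mult.assoc)
  ultimately show ?thesis by simp
qed

locale finite_local_ring =
  fixes ty :: "'a::{finite, ring_1} itself"
  assumes local: "local_ring (ring_of_type_algebra :: 'a ring)"
begin

lemma nonunits_subgroup: "subgroup (nonunits :: 'a set) (add_monoid ring_of_type_algebra)"
  using local jacobson_radical_eq_nonunits[OF local]
  by (simp add: local_ring_def jacobson_radical_ring_of_type_algebra[OF local])

lemma zero_nonunit: "(0::'a) \<in> nonunits"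
  by (simp add: nonunits_def)

lemma add_nonunit: "x \<in> nonunits \<Longrightarrow> y \<in> nonunits \<Longrightarrow> x + y \<in> nonunits" for x y :: 'a
  using subgroup.m_closed[OF nonunits_subgroup] by simp

text \<open>If \<open>y\<close> inverted \<open>r * x\<close>, then \<open>y * r\<close> would be a
  left inverse of \<open>x\<close>, which finiteness makes two-sided.\<close>

lemma mult_nonunit_left:
  fixes x r :: 'a
  assumes "x \<in> nonunits"
  shows "r * x \<in> nonunits"
proof (rule ccontr)
  assume "r * x \<notin> nonunits"
  then obtain y where "y * r * x = 1" by (auto simp: nonunits_def mult.assoc)
  with left_inverse_imp_right_inverse[OF this] assms show False by (auto simp: nonunits_def)
qed

lemma mult_nonunit_right:
  fixes x r :: 'a
  assumes "x \<in> nonunits"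
  shows "x * r \<in> nonunits"
proof (rule ccontr)
  assume "x * r \<notin> nonunits"
  then obtain y where "x * (r * y) = 1" by (auto simp: nonunits_def mult.assoc)
  with left_inverse_imp_right_inverse[OF this] assms show False by (auto simp: nonunits_def)
qed

text \<open>Otherwise \<open>x\<close> and \<open>1 - x\<close> would both be nonunits, and so would
  their sum \<open>1\<close>.\<close>

lemma one_minus_nonunit:
  fixes x :: 'a
  assumes "x \<in> nonunits"
  shows "\<exists>y. y * (1 - x) = 1"
proof (rule ccontr)
  assume "\<nexists>y. y * (1 - x) = 1"
  then have "1 - x \<in> nonunits" by (auto simp: nonunits_def)
  then have "1 \<in> (nonunits :: 'a set)" using add_nonunit[OF assms, of "1 - x"] by simp
  then show False by (auto simp: nonunits_def)
qed

section \<open>Nilpotency of the radical by a filtration\<close>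

text \<open>\<open>annihilated m\<close> is the set of elements killed on the left by all products of \<open>m\<close> nonunits.\<close>

primrec annihilated :: "nat \<Rightarrow> 'a set" where
  "annihilated 0 = {0}"
| "annihilated (Suc m) = {s. \<forall>j\<in>nonunits. j * s \<in> annihilated m}"

lemma annihilated_zero: "0 \<in> annihilated m"
  by (induction m) auto

lemma annihilated_add: "x \<in> annihilated m \<Longrightarrow> y \<in> annihilated m \<Longrightarrow> x + y \<in> annihilated m"
  by (induction m arbitrary: x y) (auto simp: distrib_left)

lemma annihilated_sum: "(\<And>i. i \<in> I \<Longrightarrow> f i \<in> annihilated m) \<Longrightarrow> sum f I \<in> annihilated m"
  by (induction I rule: infinite_finite_induct) (auto simp: annihilated_zero annihilated_add)

lemma annihilated_Suc: "annihilated m \<subseteq> annihilated (Suc m)"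
  by (induction m) auto

lemma annihilated_mono: "m \<le> k \<Longrightarrow> annihilated m \<subseteq> annihilated k"
  using lift_Suc_mono_le[of annihilated] annihilated_Suc by blast

text \<open>For a nonunit \<open>j\<close> and \<open>s \<noteq> 0\<close> the left ideal \<open>R j s\<close> is strictly smaller than \<open>R s\<close>, which
  replaces the nilpotency of the radical.\<close>

lemma in_annihilated_card: "s \<in> annihilated (card (range (\<lambda>r. r * s)))"
proof (induction "card (range (\<lambda>r. r * s))" arbitrary: s rule: less_induct)
  case less
  have "card (range (\<lambda>r. r * s)) \<noteq> 0" by simp
  then obtain m where m: "card (range (\<lambda>r. r * s)) = Suc m"
    using not0_implies_Suc by blast
  have "j * s \<in> annihilated m" if j: "j \<in> nonunits" for j
  proof (cases "s = 0")
    case True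
    then show ?thesis by (simp add: annihilated_zero)
  next
    case False
    have sub: "range (\<lambda>r. r * (j * s)) \<subseteq> range (\<lambda>r. r * s)"
      by (auto simp flip: mult.assoc)
    moreover have "s \<notin> range (\<lambda>r. r * (j * s))"
    proof
      assume "s \<in> range (\<lambda>r. r * (j * s))"
      then obtain r where "s = r * (j * s)" by auto
      \<comment> \<open>Nakayama's argument: \<open>r * j\<close> is a nonunit, so
        \<open>1 - r * j\<close> has a left inverse and \<open>s\<close> would vanish.\<close>
      then have "(1 - r * j) * s = 0" by (simp add: left_diff_distrib mult.assoc)
      moreover obtain y where "y * (1 - r * j) = 1"
        using one_minus_nonunit mult_nonunit_left j by blast
      ultimately have "1 * s = 0" by (metis mult.assoc mult_zero_right)
      then show False using False by simp
    qed
    moreover have "s \<in> range (\<lambda>r. r * s)" by (rule range_eqI[of _ _ 1]) simp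
    ultimately have "range (\<lambda>r. r * (j * s)) \<subset> range (\<lambda>r. r * s)" by blast
    then have "card (range (\<lambda>r. r * (j * s))) < card (range (\<lambda>r. r * s))"
      by (intro psubset_card_mono) auto
    then show ?thesis
      using less.hyps[of "j * s"] m annihilated_mono[of "card (range (\<lambda>r. r * (j * s)))" m] by auto
  qed
  then show ?case unfolding m by simp
qed

text \<open>No set \<open>range (\<lambda>r. r * s)\<close> has more than \<open>card UNIV\<close>
  elements, so one level serves for all \<open>s\<close>. Taking \<open>s = 1\<close> shows that the
  radical is nilpotent.\<close>

lemma annihilated_eq_UNIV: "annihilated (card (UNIV :: 'a set)) = UNIV"
proof -
  have "s \<in> annihilated (card (UNIV :: 'a set))" for s
    using in_annihilated_card[of s] annihilated_mono[OF card_mono[OF finite_UNIV subset_UNIV]]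
    by blast
  then show ?thesis by blast
qed

text \<open>Write \<open>M = 1 + N\<close> with \<open>N\<close> over the radical. A kernel vector
  satisfies \<open>x = - N x\<close>, and each use of this equation moves the entries of
  \<open>x\<close> one level down the filtration \<open>annihilated\<close>, whose bottom level is
  zero.\<close>

lemma mult_mat_vec_eq_0_imp:
  fixes M :: "'a mat"
  assumes M: "M \<in> carrier_mat k k"
    and J: "\<And>i j. i < k \<Longrightarrow> j < k \<Longrightarrow> (M - 1\<^sub>m k) $$ (i, j) \<in> nonunits"
    and x: "x \<in> carrier_vec k" and 0: "M *\<^sub>v x = 0\<^sub>v k"
  shows "x = 0\<^sub>v k"
proof -
  let ?N = "M - 1\<^sub>m k"
  have "?N *\<^sub>v x = M *\<^sub>v x - x"
    using minus_mult_distrib_mat_vec[OF M one_carrier_mat x] x by simp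
  then have N: "?N *\<^sub>v x = - x" using x 0 by simp
  have eq: "x $ i = (\<Sum>j<k. - (?N $$ (i, j)) * x $ j)" if i: "i < k" for i
  proof -
    have "- (x $ i) = (?N *\<^sub>v x) $ i" using i x N by simp
    also have "\<dots> = (\<Sum>j<k. ?N $$ (i, j) * x $ j)"
      using i x M by (auto simp: scalar_prod_def atLeast0LessThan intro!: sum.cong)
    finally have "x $ i = - (\<Sum>j<k. ?N $$ (i, j) * x $ j)" by (metis minus_minus)
    then show ?thesis by (simp add: sum_negf)
  qed
  have neg: "- a \<in> nonunits" if "a \<in> nonunits" for a :: 'a
    using mult_nonunit_left[OF that, of "- 1"] by simp
  have "\<forall>i<k. x $ i \<in> annihilated (card (UNIV :: 'a set) - m)" for m
  proof (induction m)
    case 0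
    then show ?case by (simp add: annihilated_eq_UNIV)
  next
    case (Suc m)
    show ?case
    proof (cases "card (UNIV :: 'a set) - m")
      \<comment> \<open>Truncated subtraction: once level 0 is reached, the claim for
        \<open>Suc m\<close> is the one for \<open>m\<close>.\<close>
      case 0
      then show ?thesis using Suc by simp
    next
      case (Suc p)
      have "x $ i \<in> annihilated p" if i: "i < k" for i
        unfolding eq[OF i]
      proof (rule annihilated_sum)
        fix j assume "j \<in> {..<k}"
        then have j: "j < k" by simp
        have "x $ j \<in> annihilated (Suc p)" using Suc.IH j Suc by simp
        then show "- (?N $$ (i, j)) * x $ j \<in> annihilated p"
          using neg[OF J[OF i j]] unfolding annihilated.simps by blast
      qed
      then show ?thesis using Suc by (simp add: diff_Suc)
    qed
  qed
  from this[of "card (UNIV :: 'a set)"] have "\<forall>i<k. x $ i = 0" by simp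
  then show ?thesis using x by auto
qed

end

section \<open>Relations in minimal generating families\<close>

text \<open>Treats left and right multiplication by scalars at once, so that parity check matrices
  and generator matrices share one theory of spans; \<open>comp\<close> is the multiplication of the
  ring or of its opposite.\<close>

locale scalar_action =
  fixes act :: "'a::ring_1 \<Rightarrow> 'a \<Rightarrow> 'a" and comp :: "'a \<Rightarrow> 'a \<Rightarrow> 'a"
  assumes act_add_left: "act (r + q) x = act r x + act q x"
    and act_add_right: "act r (x + y) = act r x + act r y"
    and act_one: "act 1 x = x"
    and act_act: "act r (act q x) = act (comp r q) x"
begin

definition vec_module :: "nat \<Rightarrow> ('a, 'a vec) module" where
  "vec_module n = (module_vec TYPE('a) n)\<lparr>module.smult := (\<lambda>r. map_vec (act r))\<rparr>"

text \<open>The index set is a parameter so that a sum can grow by one index in an induction and a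
  single vector can be left out.\<close>

definition combination :: "nat \<Rightarrow> 'a vec list \<Rightarrow> (nat \<Rightarrow> 'a) \<Rightarrow> nat set \<Rightarrow> 'a vec" where
  "combination n vs c I = vec n (\<lambda>j. \<Sum>i\<in>I. act (c i) (vs ! i $ j))"

lemma combination_carrier: "combination n vs c I \<in> carrier_vec n"
  by (simp add: combination_def)

lemma vec_module_simps [simp]:
  "carrier (vec_module n) = carrier_vec n"
  "add (vec_module n) = (+)"
  "zero (vec_module n) = 0\<^sub>v n"
  "module.smult (vec_module n) r = map_vec (act r)"
  by (simp_all add: vec_module_def module_vec_def)

lemma act_zero_right [simp]: "act r 0 = 0"
  using act_add_right[of r 0 0] by simp

lemma act_zero_left [simp]: "act 0 x = 0"
  using act_add_left[of 0 0 x] by simp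

lemma act_minus_right: "act r (- x) = - act r x"
  using act_add_right[of r x "- x"] by (simp add: eq_neg_iff_add_eq_0 add.commute)

lemma act_minus_left: "act (- r) x = - act r x"
  using act_add_left[of r "- r" x] by (simp add: eq_neg_iff_add_eq_0 add.commute)

lemma act_sum: "act r (sum f I) = (\<Sum>i\<in>I. act r (f i))"
  by (induction I rule: infinite_finite_induct) (auto simp: act_add_right)

lemma abelian_group_vec_module: "abelian_group (vec_module n)"
  using abelian_group_module_vec[where 'a = 'a and n = n]
  unfolding abelian_group_def abelian_group_axioms_def abelian_monoid_def vec_module_def
  by (simp add: module_vec_def)

text \<open>Closure under additive inverses follows from closure under scalars, since the inverse of
  \<open>x\<close> is its multiple by \<open>- 1\<close>.\<close>

lemma submodule_vec_module_iff:
  "submodule N ring_of_type_algebra (vec_module n) \<longleftrightarrow>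
     N \<subseteq> carrier_vec n \<and> 0\<^sub>v n \<in> N \<and> (\<forall>x\<in>N. \<forall>y\<in>N. x + y \<in> N) \<and> (\<forall>r. \<forall>x\<in>N. map_vec (act r) x \<in> N)"
  (is "?l \<longleftrightarrow> ?r")
proof -
  interpret M: abelian_group "vec_module n" by (rule abelian_group_vec_module)
  have inv: "inv\<^bsub>add_monoid (vec_module n)\<^esub> x = map_vec (act (- 1)) x" if "x \<in> carrier_vec n" for x
  proof -
    have "x + map_vec (act (- 1)) x = 0\<^sub>v n"
      using that by (intro eq_vecI) (auto simp: act_minus_left act_one)
    then have "\<ominus>\<^bsub>vec_module n\<^esub> x = map_vec (act (- 1)) x"
      using that by (intro M.minus_equality) (auto simp: comm_add_vec[of x n])
    then show ?thesis by (simp add: a_inv_def)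
  qed
  show ?thesis
  proof
    assume ?l
    then interpret N: submodule N ring_of_type_algebra "vec_module n" .
    show ?r
      using N.subset N.one_closed N.m_closed N.smult_closed by auto
  next
    assume ?r
    then have "inv\<^bsub>add_monoid (vec_module n)\<^esub> x \<in> N" if "x \<in> N" for x
      using that by (subst inv) auto
    with \<open>?r\<close> show ?l
      by (intro submodule.intro subgroup.intro submodule_axioms.intro) auto
  qed
qed

lemma combination_mem:
  assumes N: "submodule N ring_of_type_algebra (vec_module n)"
    and I: "finite I" "\<And>i. i \<in> I \<Longrightarrow> vs ! i \<in> N"
  shows "combination n vs c I \<in> N"
  using I
proof (induction I rule: finite_induct)
  case empty
  have "combination n vs c {} = 0\<^sub>v n"
    by (auto simp: combination_def)
  then show ?case using N by (simp add: submodule_vec_module_iff)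
next
  case (insert i I)
  then have i: "vs ! i \<in> N" "vs ! i \<in> carrier_vec n" using N by (auto simp: submodule_vec_module_iff)
  have "combination n vs c (insert i I) = map_vec (act (c i)) (vs ! i) + combination n vs c I"
    using insert.hyps i by (auto simp: combination_def)
  then show ?case using N insert i by (auto simp: submodule_vec_module_iff)
qed

lemma linear_combination:
  assumes N: "submodule N ring_of_type_algebra (vec_module n)"
    and f: "f \<in> module_homs ring_of_type_algebra ((vec_module n)\<lparr>carrier := N\<rparr>) (vec_module t)"
    and I: "finite I" "\<And>i. i \<in> I \<Longrightarrow> vs ! i \<in> N"
  shows "f (combination n vs c I) = vec t (\<lambda>j. \<Sum>i\<in>I. act (c i) (f (vs ! i) $ j))"
  using I
proof (induction I rule: finite_induct)
  case empty
  have 0: "combination n vs c {} = 0\<^sub>v n"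
    by (auto simp: combination_def)
  have N0: "0\<^sub>v n \<in> N" using N by (simp add: submodule_vec_module_iff)
  then have "f (0\<^sub>v n) \<in> carrier_vec t" using f by (auto simp: module_homs_def)
  \<comment> \<open>\<open>f\<close> preserves zero because the zero vector is its own multiple by
    the scalar \<open>0\<close>.\<close>
  moreover have "f (map_vec (act 0) (0\<^sub>v n)) = map_vec (act 0) (f (0\<^sub>v n))"
    using f N0 by (simp add: module_homs_def)
  moreover have "map_vec (act 0) (0\<^sub>v n) = 0\<^sub>v n" by auto
  moreover have "map_vec (act 0) w = 0\<^sub>v t" if "w \<in> carrier_vec t" for w
    using that by auto
  ultimately have "f (0\<^sub>v n) = 0\<^sub>v t" by simp
  then show ?case unfolding 0 by auto
next
  case (insert i I)
  then have i: "vs ! i \<in> N" "vs ! i \<in> carrier_vec n" using N by (auto simp: submodule_vec_module_iff)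
  have rest: "combination n vs c I \<in> N" using combination_mem[OF N] insert by auto
  have si: "map_vec (act (c i)) (vs ! i) \<in> N" using N i by (auto simp: submodule_vec_module_iff)
  have fi: "f (vs ! i) \<in> carrier_vec t" using f i by (auto simp: module_homs_def)
  have "combination n vs c (insert i I) = map_vec (act (c i)) (vs ! i) + combination n vs c I"
    using insert.hyps i by (auto simp: combination_def)
  then have "f (combination n vs c (insert i I))
      = map_vec (act (c i)) (f (vs ! i)) + f (combination n vs c I)"
    using f i si rest by (simp add: module_homs_def)
  then show ?case using insert fi by auto
qed

lemma submodule_combinations:
  assumes "set vs \<subseteq> carrier_vec n"
  shows "submodule (range (\<lambda>c. combination n vs c {..<length vs})) ring_of_type_algebra (vec_module n)"
proof -
  have "combination n vs c {..<length vs} + combination n vs d {..<length vs}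
      = combination n vs (\<lambda>i. c i + d i) {..<length vs}" for c d
    by (auto simp: combination_def act_add_left sum.distrib)
  moreover have "map_vec (act r) (combination n vs c {..<length vs})
      = combination n vs (\<lambda>i. comp r (c i)) {..<length vs}" for c r
    by (auto simp: combination_def act_sum act_act)
  moreover have "0\<^sub>v n = combination n vs (\<lambda>i. 0) {..<length vs}"
    by (auto simp: combination_def)
  ultimately show ?thesis
    unfolding submodule_vec_module_iff by (auto simp: combination_carrier)
qed

lemma module_span_eq_combinations:
  assumes vs: "set vs \<subseteq> carrier_vec n"
  shows "module_span ring_of_type_algebra (vec_module n) (set vs)
    = range (\<lambda>c. combination n vs c {..<length vs})"
  unfolding module_span_def
proof (rule hull_unique)
  show "set vs \<subseteq> range (\<lambda>c. combination n vs c {..<length vs})"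
  proof
    fix v assume "v \<in> set vs"
    then obtain i where i: "i < length vs" "v = vs ! i" by (auto simp: in_set_conv_nth)
    have "dim_vec (vs ! i) = n" using i vs by (auto simp: subset_iff)
    moreover have "act (if l = i then 1 else 0) x = (if l = i then x else 0)" for l x
      by (simp add: act_one)
    ultimately have "v = combination n vs (\<lambda>l. if l = i then 1 else 0) {..<length vs}"
      using i by (intro eq_vecI) (simp_all add: combination_def)
    then show "v \<in> range (\<lambda>c. combination n vs c {..<length vs})" by blast
  qed
  show "submodule (range (\<lambda>c. combination n vs c {..<length vs})) ring_of_type_algebra (vec_module n)"
    by (rule submodule_combinations[OF vs])
  show "range (\<lambda>c. combination n vs c {..<length vs}) \<subseteq> N"
    if "set vs \<subseteq> N" "submodule N ring_of_type_algebra (vec_module n)" for N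
    using combination_mem[OF that(2), of "{..<length vs}" vs] that(1)
    by (auto simp: subset_iff)
qed

text \<open>If \<open>u\<close> cancelled the coefficient \<open>c i\<close>, the relation could be
  solved for \<open>vs ! i\<close>, which would then be redundant. For the left action this excludes
  a left inverse of \<open>c i\<close>, for the right action a right inverse.\<close>

lemma minimal_generating_relation:
  assumes vs: "set vs \<subseteq> carrier_vec n" and dist: "distinct vs"
    and min: "minimal_generating_set ring_of_type_algebra (vec_module n) C (set vs)"
    and rel: "combination n vs c {..<length vs} = 0\<^sub>v n"
    and i: "i < length vs"
  shows "comp u (c i) \<noteq> 1"
proof
  assume u: "comp u (c i) = 1"
  let ?T = "set vs - {vs ! i}" and ?I = "{..<length vs} - {i}"
  let ?sub = "\<lambda>N. submodule N ring_of_type_algebra (vec_module n)"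
  have vi: "vs ! i \<in> carrier_vec n" using vs i by (auto simp: subset_iff)
  have "vs ! i \<in> N" if N: "?sub N" "?T \<subseteq> N" for N
  proof -
    \<comment> \<open>By distinctness no other index holds a copy of \<open>vs ! i\<close>, so these
      vectors all remain in \<open>?T\<close>.\<close>
    have "vs ! l \<in> N" if "l \<in> ?I" for l
      using that N(2) dist i by (auto simp: nth_eq_iff_index_eq subset_iff)
    then have mem: "combination n vs c ?I \<in> N"
      by (intro combination_mem[OF N(1)]) auto
    have "act (c i) (vs ! i $ j) + (\<Sum>l\<in>?I. act (c l) (vs ! l $ j)) = 0" if "j < n" for j
    proof -
      have "act (c i) (vs ! i $ j) + (\<Sum>l\<in>?I. act (c l) (vs ! l $ j))
          = (\<Sum>l<length vs. act (c l) (vs ! l $ j))"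
        using i by (intro sum.remove[symmetric]) auto
      also have "\<dots> = combination n vs c {..<length vs} $ j"
        using that by (simp add: combination_def)
      finally show ?thesis using that unfolding rel by simp
    qed
    then have "combination n vs c ?I $ j = - act (c i) (vs ! i $ j)" if "j < n" for j
      using that by (simp add: combination_def add_eq_0_iff)
    moreover have "act (- u) (- act (c i) x) = x" for x
    proof -
      have "act (- u) (- act (c i) x) = act u (act (c i) x)"
        by (simp only: act_minus_left act_minus_right minus_minus)
      then show ?thesis by (simp add: act_act u act_one)
    qed
    ultimately have "vs ! i = map_vec (act (- u)) (combination n vs c ?I)"
      using vi carrier_vecD[OF combination_carrier[of n vs c ?I]] by (intro eq_vecI) auto
    then show ?thesis using mem N(1) by (simp add: submodule_vec_module_iff)
  qed
  then have "vs ! i \<in> ?sub hull ?T" unfolding hull_def by blast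
  then have "?sub hull insert (vs ! i) ?T = ?sub hull ?T" by (rule hull_redundant)
  moreover have "insert (vs ! i) ?T = set vs" using i by auto
  ultimately have "module_span ring_of_type_algebra (vec_module n) ?T = C"
    using min by (simp add: minimal_generating_set_def module_span_def)
  moreover have "vs ! i \<in> set vs" using i by simp
  then have "?T \<subset> set vs" by blast
  ultimately show False using min unfolding minimal_generating_set_def by blast
qed

end

interpretation left_action: scalar_action "\<lambda>r x :: 'a::ring_1. r * x" "\<lambda>r q. r * q"
  by unfold_locales (auto simp: algebra_simps)

text \<open>The composition is reversed: acting by \<open>q\<close> and then by \<open>r\<close>
  multiplies on the right by \<open>q * r\<close>.\<close>

interpretation right_action: scalar_action "\<lambda>r x :: 'a::ring_1. x * r" "\<lambda>r q. q * r"
  by unfold_locales (auto simp: algebra_simps)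

lemma left_action_vec_module:
  "left_action.vec_module n = module_vec TYPE('a::ring_1) n"
  unfolding left_action.vec_module_def module_vec_def by (auto simp: fun_eq_iff smult_vec_def map_vec_def)

lemma right_action_vec_module:
  "right_action.vec_module n = right_module_vec TYPE('a::ring_1) n"
  unfolding right_action.vec_module_def right_module_vec_def ..

lemma right_action_combination:
  assumes "G \<in> carrier_mat k n"
  shows "right_action.combination n (rows G) c {..<length (rows G)} = transpose_mat G *\<^sub>v vec k c"
  using assms
  by (intro eq_vecI) (auto simp: right_action.combination_def scalar_prod_def atLeast0LessThan)

text \<open>This is a row vector times \<open>H\<close>, written column by column. Multiplying the
  transpose of \<open>H\<close> by a vector would put the coefficients on the wrong side of the
  entries.\<close>

lemma left_action_combination:
  assumes "H \<in> carrier_mat m n"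
  shows "left_action.combination n (rows H) c {..<length (rows H)} = vec n (\<lambda>j. vec m c \<bullet> col H j)"
  using assms
  by (intro eq_vecI) (auto simp: left_action.combination_def scalar_prod_def atLeast0LessThan)

section \<open>Invertibility modulo the radical\<close>

lemma inj_on_mult_mat_vec_iff:
  fixes A :: "'a::ring_1 mat"
  assumes A: "A \<in> carrier_mat m k"
  shows "inj_on ((*\<^sub>v) A) (carrier_vec k) \<longleftrightarrow> (\<forall>x\<in>carrier_vec k. A *\<^sub>v x = 0\<^sub>v m \<longrightarrow> x = 0\<^sub>v k)"
proof
  assume inj: "inj_on ((*\<^sub>v) A) (carrier_vec k)"
  have "A *\<^sub>v 0\<^sub>v k = 0\<^sub>v m" using A by auto
  then show "\<forall>x\<in>carrier_vec k. A *\<^sub>v x = 0\<^sub>v m \<longrightarrow> x = 0\<^sub>v k"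
    using inj zero_carrier_vec[of k] unfolding inj_on_def by metis
next
  assume ker: "\<forall>x\<in>carrier_vec k. A *\<^sub>v x = 0\<^sub>v m \<longrightarrow> x = 0\<^sub>v k"
  show "inj_on ((*\<^sub>v) A) (carrier_vec k)"
  proof (rule inj_onI)
    fix x y :: "'a vec"
    assume xy: "x \<in> carrier_vec k" "y \<in> carrier_vec k" "A *\<^sub>v x = A *\<^sub>v y"
    have "A *\<^sub>v (x - y) = 0\<^sub>v m"
      using A xy by (simp add: mult_minus_distrib_mat_vec)
    then have d: "x - y = 0\<^sub>v k" using ker xy by auto
    have "x $ i = y $ i" if "i < k" for i
      using arg_cong[OF d, of "\<lambda>v. v $ i"] that xy by simp
    then show "x = y" using xy by auto
  qed
qed

lemma mat_eq_iff_mult_vec: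
  fixes A B :: "'a::ring_1 mat"
  assumes A: "A \<in> carrier_mat m k" and B: "B \<in> carrier_mat m k"
    and eq: "\<And>x. x \<in> carrier_vec k \<Longrightarrow> A *\<^sub>v x = B *\<^sub>v x"
  shows "A = B"
proof (rule eq_matI)
  fix i j assume "i < dim_row B" "j < dim_col B"
  then have i: "i < m" and j: "j < k" using B by auto
  have "(A *\<^sub>v unit_vec k j) $ i = (B *\<^sub>v unit_vec k j) $ i" using eq by simp
  then show "A $$ (i, j) = B $$ (i, j)" using A B i j by simp
qed (use A B in auto)

text \<open>The columns of \<open>Y\<close> are chosen preimages of the columns of
  \<open>B\<close>.\<close>

lemma exists_mat_mult_eq:
  fixes A :: "'a::ring_1 mat"
  assumes A: "A \<in> carrier_mat m k" and B: "B \<in> carrier_mat m l"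
    and surj: "\<And>j. j < l \<Longrightarrow> \<exists>x\<in>carrier_vec k. A *\<^sub>v x = col B j"
  obtains Y where "Y \<in> carrier_mat k l" "A * Y = B"
proof -
  obtain y where y: "\<And>j. j < l \<Longrightarrow> y j \<in> carrier_vec k \<and> A *\<^sub>v y j = col B j"
    using surj by metis
  let ?Y = "mat k l (\<lambda>(i, j). y j $ i)"
  have "col ?Y j = y j" if "j < l" for j using y[OF that] that by auto
  then have "A * ?Y = B"
  proof (intro eq_matI)
    fix i j assume c: "\<And>j. j < l \<Longrightarrow> col ?Y j = y j" "i < dim_row B" "j < dim_col B"
    then have "(A * ?Y) $$ (i, j) = (A *\<^sub>v y j) $ i" using A B by simp
    also have "\<dots> = B $$ (i, j)" using y[of j] c B by simp
    finally show "(A * ?Y) $$ (i, j) = B $$ (i, j)" .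
  qed (use A B in auto)
  then show thesis using that[of ?Y] by simp
qed

section \<open>Counting vectors and inverting square matrices over a finite ring\<close>

lemma finite_carrier_vec: "finite (carrier_vec n :: 'a::finite vec set)"
  and card_carrier_vec: "card (carrier_vec n :: 'a vec set) = card (UNIV :: 'a set) ^ n"
proof -
  let ?L = "{xs :: 'a list. set xs \<subseteq> UNIV \<and> length xs = n}"
  have bij: "bij_betw list_of_vec (carrier_vec n) ?L"
    by (rule bij_betwI[of _ _ _ vec_of_list]) (auto simp: vec_list list_vec intro: carrier_vecI)
  show "finite (carrier_vec n :: 'a vec set)"
    using bij_betw_finite[OF bij] finite_lists_length_eq[OF finite_UNIV, of n] by blast
  show "card (carrier_vec n :: 'a vec set) = card (UNIV :: 'a set) ^ n"
    using bij_betw_same_card[OF bij] card_lists_length_eq[OF finite_UNIV, of n] by metis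
qed

text \<open>Powers of the cardinality of the ring then have distinct values for distinct exponents,
  so counting determines ranks.\<close>

lemma card_UNIV_ge_2: "2 \<le> card (UNIV :: 'a::{finite, zero_neq_one} set)"
  using card_mono[of UNIV "{0, 1 :: 'a}"] by simp

lemma inj_on_mult_left_imp:
  fixes A B :: "'a::ring_1 mat"
  assumes AB: "A \<in> carrier_mat l k" "B \<in> carrier_mat m l"
    and inj: "inj_on ((*\<^sub>v) (B * A)) (carrier_vec k)"
  shows "inj_on ((*\<^sub>v) A) (carrier_vec k)"
proof (rule inj_onI)
  fix x y assume xy: "x \<in> carrier_vec k" "y \<in> carrier_vec k" "A *\<^sub>v x = A *\<^sub>v y"
  then have "B * A *\<^sub>v x = B * A *\<^sub>v y" using AB by simp
  then show "x = y" using inj xy(1,2) by (simp add: inj_on_eq_iff)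
qed

text \<open>By finiteness \<open>A\<close> is also onto, and preimages of the unit vectors form a
  right inverse \<open>B\<close>. Cancelling the injective \<open>A\<close> in
  \<open>A B A = A\<close> gives \<open>B A = 1\<close>.\<close>

lemma inj_mat_imp_inverse:
  fixes A :: "'a::{finite, ring_1} mat"
  assumes A: "A \<in> carrier_mat k k" and inj: "inj_on ((*\<^sub>v) A) (carrier_vec k)"
  obtains B where "B \<in> carrier_mat k k" "A * B = 1\<^sub>m k" "B * A = 1\<^sub>m k"
proof -
  have "(*\<^sub>v) A ` carrier_vec k = carrier_vec k"
    by (rule endo_inj_surj[OF finite_carrier_vec _ inj]) (use A in auto)
  moreover have "col (1\<^sub>m k) j \<in> carrier_vec k" for j
    by (rule carrier_vecI) simp
  ultimately have "\<exists>x\<in>carrier_vec k. A *\<^sub>v x = col (1\<^sub>m k) j" for j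
    by (metis imageE)
  then obtain B where B: "B \<in> carrier_mat k k" "A * B = 1\<^sub>m k"
    using exists_mat_mult_eq[OF A one_carrier_mat] by blast
  have "(B * A) *\<^sub>v x = 1\<^sub>m k *\<^sub>v x" if x: "x \<in> carrier_vec k" for x
  proof (rule inj_onD[OF inj])
    have "A *\<^sub>v ((B * A) *\<^sub>v x) = (A * B) *\<^sub>v (A *\<^sub>v x)"
      using A B(1) x by simp
    then show "A *\<^sub>v ((B * A) *\<^sub>v x) = A *\<^sub>v (1\<^sub>m k *\<^sub>v x)"
      using A B(2) x by simp
  qed (use A B x in auto)
  then have "B * A = 1\<^sub>m k"
    using A B by (intro mat_eq_iff_mult_vec[of _ k k]) auto
  then show thesis using that B by blast
qed

section \<open>Reduction of matrices modulo the radical, and lifting\<close>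

context finite_local_ring
begin

abbreviation residue :: "'a \<Rightarrow> 'a set" where
  "residue \<equiv> residue_map (ring_of_type_algebra :: 'a ring)"

abbreviation residues :: "'a set ring" where
  "residues \<equiv> residue_field (ring_of_type_algebra :: 'a ring)"

lemma ideal_nonunits: "ideal (nonunits :: 'a set) ring_of_type_algebra"
  by (rule idealI[OF ring_ring_of_type_algebra nonunits_subgroup])
     (auto intro: mult_nonunit_left mult_nonunit_right)

lemma residue_def: "residue x = nonunits +>\<^bsub>ring_of_type_algebra\<^esub> x"
  by (simp add: residue_map_def jacobson_radical_ring_of_type_algebra[OF local])

lemma residues_def: "residues = ring_of_type_algebra Quot nonunits"
  by (simp add: residue_field_def jacobson_radical_ring_of_type_algebra[OF local])

lemma residue_eq_iff: "residue x = residue y \<longleftrightarrow> x - y \<in> nonunits"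
proof -
  have mem: "z \<in> residue y \<longleftrightarrow> z - y \<in> nonunits" for z y
    by (auto simp: residue_def a_r_coset_def r_coset_def intro: bexI[of _ "z - y"])
  have neg: "- z \<in> nonunits" if "z \<in> nonunits" for z :: 'a
    using mult_nonunit_left[OF that, of "- 1"] by simp
  have "z - y \<in> nonunits" if "z - x \<in> nonunits" "x - y \<in> nonunits" for x y z :: 'a
    using add_nonunit[OF that] by simp
  moreover have "y - x \<in> nonunits" if "x - y \<in> nonunits"
    using neg[OF that] by simp
  moreover have "x \<in> residue x" using zero_nonunit by (simp add: mem)
  ultimately show ?thesis unfolding set_eq_iff mem using mem by blast
qed

sublocale residue: ring_hom_ring "ring_of_type_algebra :: 'a ring" residues residue
  using ideal.rcos_ring_hom_ring[OF ideal_nonunits]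
  unfolding residues_def residue_def[abs_def] .

lemma residue_sum:
  assumes "finite I"
  shows "residue (sum f I) = (\<Oplus>\<^bsub>residues\<^esub>i\<in>I. residue (f i))"
  using assms
proof (induction I rule: finite_induct)
  case empty
  then show ?case using residue.hom_zero by simp
next
  case (insert i I)
  have "residue (f i + sum f I) = residue (f i) \<oplus>\<^bsub>residues\<^esub> residue (sum f I)"
    using residue.hom_add[of "f i" "sum f I"] by simp
  then show ?case using insert residue.hom_closed by (simp add: residue.S.finsum_insert)
qed

lemma map_mat_residue_mult:
  assumes A: "A \<in> carrier_mat m k" and B: "B \<in> carrier_mat k l"
  shows "map_mat residue (A * B) = mat_prod_over residues (map_mat residue A) (map_mat residue B)"
proof (rule eq_matI)
  fix i j
  assume "i < dim_row (mat_prod_over residues (map_mat residue A) (map_mat residue B))"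
    "j < dim_col (mat_prod_over residues (map_mat residue A) (map_mat residue B))"
  then have i: "i < m" and j: "j < l" using A B by (auto simp: mat_prod_over_def)
  have "map_mat residue (A * B) $$ (i, j) = residue (\<Sum>x<k. A $$ (i, x) * B $$ (x, j))"
    using A B i j by (simp add: scalar_prod_def atLeast0LessThan)
  also have "\<dots> = (\<Oplus>\<^bsub>residues\<^esub>x\<in>{..<k}. residue (A $$ (i, x) * B $$ (x, j)))"
    by (rule residue_sum) simp
  also have "\<dots> = (\<Oplus>\<^bsub>residues\<^esub>x\<in>{..<k}. residue (A $$ (i, x)) \<otimes>\<^bsub>residues\<^esub> residue (B $$ (x, j)))"
    using residue.hom_mult by simp
  also have "\<dots> = (\<Oplus>\<^bsub>residues\<^esub>x\<in>{..<k}.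
      map_mat residue A $$ (i, x) \<otimes>\<^bsub>residues\<^esub> map_mat residue B $$ (x, j))"
    using A B i j residue.hom_closed by (intro residue.S.finsum_cong') auto
  finally show "map_mat residue (A * B) $$ (i, j)
      = mat_prod_over residues (map_mat residue A) (map_mat residue B) $$ (i, j)"
    using A B i j by (simp add: mat_prod_over_def)
qed (use A B in \<open>auto simp: mat_prod_over_def\<close>)

lemma map_mat_residue_one: "map_mat residue (1\<^sub>m k) = one_mat_over residues k"
  using residue.hom_one residue.hom_zero by (intro eq_matI) (auto simp: one_mat_over_def)

lemma map_mat_residue_mem: "A \<in> carrier_mat m k \<Longrightarrow> map_mat residue A \<in> mats_over residues m k"
  using residue.hom_closed by (auto simp: mats_over_def)

text \<open>Choosing a representative of each coset lifts the entries; this is applied to an inverse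
  over the residue field.\<close>

lemma mats_over_residues_lift:
  assumes B: "B \<in> mats_over residues m k"
  obtains B' where "B' \<in> carrier_mat m k" "B = map_mat residue B'"
proof -
  have "\<exists>x. y = residue x" if "y \<in> carrier residues" for y
    using that by (auto simp: residues_def residue_def FactRing_def A_RCOSETS_def')
  then obtain f where f: "\<And>y. y \<in> carrier residues \<Longrightarrow> residue (f y) = y" by metis
  have "B $$ (i, j) \<in> carrier residues" if "i < m" "j < k" for i j
    using B that by (auto simp: mats_over_def)
  then have "B = map_mat residue (map_mat f B)"
    using B f by (intro eq_matI) (auto simp: mats_over_def)
  moreover have "map_mat f B \<in> carrier_mat m k" using B by (auto simp: mats_over_def)
  ultimately show thesis using that by blast
qed

lemma inj_of_minus_one_nonunits:
  assumes M: "M \<in> carrier_mat k k"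
    and "\<And>i j. i < k \<Longrightarrow> j < k \<Longrightarrow> (M - 1\<^sub>m k) $$ (i, j) \<in> (nonunits :: 'a set)"
  shows "inj_on ((*\<^sub>v) M) (carrier_vec k)"
  unfolding inj_on_mult_mat_vec_iff[OF M] using mult_mat_vec_eq_0_imp[OF M] assms(2) by blast

lemma inj_of_residue_eq_one:
  assumes M: "M \<in> carrier_mat k k" and 1: "map_mat residue M = map_mat residue (1\<^sub>m k)"
  shows "inj_on ((*\<^sub>v) M) (carrier_vec k)"
proof -
  have "(M - 1\<^sub>m k) $$ (i, j) \<in> nonunits" if "i < k" "j < k" for i j
  proof -
    have "residue (M $$ (i, j)) = residue (1\<^sub>m k $$ (i, j))"
      using arg_cong[OF 1, of "\<lambda>A. A $$ (i, j)"] M that by simp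
    then show ?thesis using M that by (simp add: residue_eq_iff)
  qed
  then show ?thesis by (rule inj_of_minus_one_nonunits[OF M])
qed

text \<open>An inverse modulo the radical lifts to some \<open>B'\<close> with \<open>B' * A\<close>
  congruent to the identity, hence injective, and so is \<open>A\<close>. Conversely an injective
  square matrix has an inverse over the ring, which can be reduced.\<close>

lemma invertible_over_ring_iff_inj:
  fixes A :: "'a mat"
  assumes A: "A \<in> carrier_mat k k"
  shows "invertible_over_ring A \<longleftrightarrow> inj_on ((*\<^sub>v) A) (carrier_vec k)"
proof
  assume "invertible_over_ring A"
  then obtain l B where lB: "map_mat residue A \<in> mats_over residues l l" "B \<in> mats_over residues l l"
      "mat_prod_over residues B (map_mat residue A) = one_mat_over residues l"
    by (auto simp: invertible_over_ring_def invertible_mat_over_def)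
  then have [simp]: "l = k" using A by (auto simp: mats_over_def)
  obtain B' where B': "B' \<in> carrier_mat k k" "B = map_mat residue B'"
    using mats_over_residues_lift[OF lB(2)] by auto
  have "map_mat residue (B' * A) = map_mat residue (1\<^sub>m k)"
    unfolding map_mat_residue_mult[OF B'(1) A] map_mat_residue_one using B' lB by simp
  then have "inj_on ((*\<^sub>v) (B' * A)) (carrier_vec k)"
    using A B' by (intro inj_of_residue_eq_one) auto
  then show "inj_on ((*\<^sub>v) A) (carrier_vec k)"
    by (rule inj_on_mult_left_imp[OF A B'(1)])
next
  assume "inj_on ((*\<^sub>v) A) (carrier_vec k)"
  then obtain B where B: "B \<in> carrier_mat k k" "A * B = 1\<^sub>m k" "B * A = 1\<^sub>m k"
    using inj_mat_imp_inverse[OF A] by blast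
  then have "mat_prod_over residues (map_mat residue A) (map_mat residue B) = one_mat_over residues k"
    "mat_prod_over residues (map_mat residue B) (map_mat residue A) = one_mat_over residues k"
    using map_mat_residue_mult[OF A B(1)] map_mat_residue_mult[OF B(1) A]
    by (simp_all add: map_mat_residue_one)
  then have "invertible_mat_over residues (map_mat residue A)"
    unfolding invertible_mat_over_def using map_mat_residue_mem[OF A] map_mat_residue_mem[OF B(1)]
    by blast
  then show "invertible_over_ring A"
    using A by (simp add: invertible_over_ring_def)
qed

end

section \<open>Free codes\<close>

lemma generator_matrixD:
  fixes C :: "'a::ring_1 vec set"
  assumes "generator_matrix n C G"
  shows "G \<in> carrier_mat (dim_row G) n" "distinct (rows G)" "set (rows G) \<subseteq> carrier_vec n"
    "minimal_generating_set ring_of_type_algebra (right_action.vec_module n) C (set (rows G))"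
  using assms rows_carrier[of G] by (auto simp: generator_matrix_def right_action_vec_module)

lemma parity_check_matrixD:
  fixes C :: "'a::ring_1 vec set"
  assumes "parity_check_matrix n C H"
  shows "H \<in> carrier_mat (dim_row H) n" "distinct (rows H)" "set (rows H) \<subseteq> carrier_vec n"
    "minimal_generating_set ring_of_type_algebra (left_action.vec_module n) (dual_code n C) (set (rows H))"
  using assms rows_carrier[of H] by (auto simp: parity_check_matrix_def left_action_vec_module)

lemma generator_matrix_image:
  fixes C :: "'a::ring_1 vec set"
  assumes "generator_matrix n C G"
  shows "C = (*\<^sub>v) (transpose_mat G) ` carrier_vec (dim_row G)"
proof -
  note G = generator_matrixD[OF assms]
  have "C = range (\<lambda>c. right_action.combination n (rows G) c {..<length (rows G)})"
    using right_action.module_span_eq_combinations[OF G(3)] G(4)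
    unfolding minimal_generating_set_def by metis
  also have "\<dots> = range (\<lambda>c. transpose_mat G *\<^sub>v vec (dim_row G) c)"
    unfolding right_action_combination[OF G(1)] ..
  also have "\<dots> = (*\<^sub>v) (transpose_mat G) ` carrier_vec (dim_row G)"
  proof (intro equalityI subsetI)
    fix y assume "y \<in> (*\<^sub>v) (transpose_mat G) ` carrier_vec (dim_row G)"
    then obtain x where x: "x \<in> carrier_vec (dim_row G)" "y = transpose_mat G *\<^sub>v x" by blast
    have "x = vec (dim_row G) (\<lambda>i. x $ i)"
      using x(1) by (intro eq_vecI) simp_all
    then show "y \<in> range (\<lambda>c. transpose_mat G *\<^sub>v vec (dim_row G) c)"
      using x(2) by (metis rangeI)
  next
    fix y assume "y \<in> range (\<lambda>c. transpose_mat G *\<^sub>v vec (dim_row G) c)"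
    then obtain c where "y = transpose_mat G *\<^sub>v vec (dim_row G) c" by blast
    then show "y \<in> (*\<^sub>v) (transpose_mat G) ` carrier_vec (dim_row G)" by simp
  qed
  finally show ?thesis .
qed

lemma parity_check_matrix_rows:
  fixes C :: "'a::ring_1 vec set"
  assumes "parity_check_matrix n C H"
  shows "dual_code n C = range (\<lambda>c. vec n (\<lambda>j. vec (dim_row H) c \<bullet> col H j))"
    and "set (rows H) \<subseteq> dual_code n C"
proof -
  note H = parity_check_matrixD[OF assms]
  have span: "module_span ring_of_type_algebra (left_action.vec_module n) (set (rows H)) = dual_code n C"
    using H(4) by (simp add: minimal_generating_set_def)
  have "dual_code n C = range (\<lambda>c. left_action.combination n (rows H) c {..<length (rows H)})"
    using left_action.module_span_eq_combinations[OF H(3)] span by metis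
  also have "\<dots> = range (\<lambda>c. vec n (\<lambda>j. vec (dim_row H) c \<bullet> col H j))"
    unfolding left_action_combination[OF H(1)] ..
  finally show "dual_code n C = range (\<lambda>c. vec n (\<lambda>j. vec (dim_row H) c \<bullet> col H j))" .
  show "set (rows H) \<subseteq> dual_code n C"
    unfolding span[symmetric] module_span_def by (rule hull_subset)
qed

text \<open>Each column of \<open>B\<close> is a relation between the rows of \<open>G\<close> with
  coefficients on the right, so minimality forbids a right inverse of any entry.\<close>

lemma generator_matrix_relation:
  fixes C :: "'a::ring_1 vec set"
  assumes gen: "generator_matrix n C G"
    and B: "B \<in> carrier_mat (dim_row G) l" and 0: "transpose_mat G * B = 0\<^sub>m n l"
    and ij: "i < dim_row G" "j < l"
  shows "B $$ (i, j) \<in> nonunits"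
proof -
  note G = generator_matrixD[OF gen]
  have "vec (dim_row G) (\<lambda>i. B $$ (i, j)) = col B j"
    using B ij by (intro eq_vecI) simp_all
  then have "right_action.combination n (rows G) (\<lambda>i. B $$ (i, j)) {..<length (rows G)}
      = transpose_mat G *\<^sub>v col B j"
    using right_action_combination[OF G(1), of "\<lambda>i. B $$ (i, j)"] by simp
  also have "\<dots> = col (transpose_mat G * B) j"
    using B ij by (intro eq_vecI) simp_all
  also have "\<dots> = 0\<^sub>v n" using ij unfolding 0 by (intro eq_vecI) simp_all
  finally have rel: "right_action.combination n (rows G) (\<lambda>i. B $$ (i, j)) {..<length (rows G)} = 0\<^sub>v n" .
  have "B $$ (i, j) * u \<noteq> 1" for u
    using right_action.minimal_generating_relation[OF G(3,2,4) rel, of i u] ij by simp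
  then show ?thesis by (simp add: nonunits_def)
qed

text \<open>Here the rows of \<open>B\<close> are the relations, with coefficients on the left, so
  left inverses of entries are excluded.\<close>

lemma parity_check_matrix_relation:
  fixes C :: "'a::ring_1 vec set"
  assumes par: "parity_check_matrix n C H"
    and B: "B \<in> carrier_mat l (dim_row H)" and 0: "B * H = 0\<^sub>m l n"
    and ij: "i < l" "j < dim_row H"
  shows "B $$ (i, j) \<in> nonunits"
proof -
  note H = parity_check_matrixD[OF par]
  have "vec (dim_row H) (\<lambda>j. B $$ (i, j)) = row B i"
    using B ij by (intro eq_vecI) simp_all
  then have "left_action.combination n (rows H) (\<lambda>j. B $$ (i, j)) {..<length (rows H)}
      = vec n (\<lambda>l. row B i \<bullet> col H l)"
    using left_action_combination[OF H(1), of "\<lambda>j. B $$ (i, j)"] by simp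
  also have "\<dots> = row (B * H) i"
    using carrier_matD(2)[OF H(1)] B ij by (intro eq_vecI) simp_all
  also have "\<dots> = 0\<^sub>v n" using ij unfolding 0 by (intro eq_vecI) simp_all
  finally have rel: "left_action.combination n (rows H) (\<lambda>j. B $$ (i, j)) {..<length (rows H)} = 0\<^sub>v n" .
  have "u * B $$ (i, j) \<noteq> 1" for u
    using left_action.minimal_generating_relation[OF H(3,2,4) rel, of j u] ij by simp
  then show ?thesis by (simp add: nonunits_def)
qed

section \<open>Minimal generators of a free code form a basis\<close>

context finite_local_ring
begin

text \<open>Let \<open>\<phi>\<close> identify \<open>C\<close> with a free module and let
  \<open>A\<close> be its matrix on the generators. A right inverse \<open>Y\<close> of
  \<open>A\<close> satisfies \<open>P Y A = P\<close>, so the columns of \<open>Y A - 1\<close> are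
  relations between the generators. Their entries are nonunits, hence \<open>Y A\<close> is
  injective, then \<open>A\<close>, and finally \<open>P\<close>.\<close>

lemma free_code_generator_inj:
  fixes C :: "'a vec set"
  assumes free: "free_linear_code n C" and gen: "generator_matrix n C G"
  shows "inj_on ((*\<^sub>v) (transpose_mat G)) (carrier_vec (dim_row G))"
proof -
  define k where "k = dim_row G"
  define P where "P = transpose_mat G"
  have G: "G \<in> carrier_mat k n" using gen by (auto simp: generator_matrix_def k_def)
  then have P: "P \<in> carrier_mat n k" by (simp add: P_def)
  have C: "C = (*\<^sub>v) P ` carrier_vec k"
    using generator_matrix_image[OF gen] by (simp add: P_def k_def)
  have sub: "submodule C ring_of_type_algebra (right_action.vec_module n)"
    using free by (simp add: free_linear_code_def linear_code_def right_action_vec_module)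
  obtain t \<phi> where
    hom: "\<phi> \<in> module_homs ring_of_type_algebra ((right_action.vec_module n)\<lparr>carrier := C\<rparr>)
      (right_action.vec_module t)" and bij: "bij_betw \<phi> C (carrier_vec t)"
    using free unfolding free_linear_code_def free_right_module_def module_isomorphic_def
    by (auto simp flip: right_action_vec_module)
  define A where "A = mat t k (\<lambda>(i, j). \<phi> (row G j) $ i)"
  have A: "A \<in> carrier_mat t k" by (simp add: A_def)
  have rows: "row G j \<in> C" if "j < k" for j
  proof -
    have "P *\<^sub>v unit_vec k j = row G j"
      using that G by (intro eq_vecI) (auto simp: P_def)
    then show ?thesis unfolding C using that by (metis imageI unit_vec_carrier)
  qed
  have \<phi>: "\<phi> (P *\<^sub>v x) = A *\<^sub>v x" if x: "x \<in> carrier_vec k" for x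
  proof -
    have x': "vec k (\<lambda>i. x $ i) = x" using x by auto
    have "\<phi> (right_action.combination n (rows G) (\<lambda>i. x $ i) {..<length (rows G)})
        = vec t (\<lambda>j. \<Sum>i<length (rows G). \<phi> (rows G ! i) $ j * x $ i)"
      using rows G by (intro right_action.linear_combination[OF sub hom]) auto
    also have "\<dots> = A *\<^sub>v x"
      using x G by (intro eq_vecI) (auto simp: A_def scalar_prod_def atLeast0LessThan)
    finally show ?thesis unfolding right_action_combination[OF G] x' P_def .
  qed
  \<comment> \<open>Since \<open>\<phi>\<close> is onto, every unit vector has the form
    \<open>A x\<close>.\<close>
  have "\<exists>x\<in>carrier_vec k. A *\<^sub>v x = col (1\<^sub>m t) j" if "j < t" for j
  proof -
    have "col (1\<^sub>m t) j \<in> \<phi> ` C"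
      using bij that by (auto simp: bij_betw_def)
    then show ?thesis using \<phi> unfolding C by auto
  qed
  then obtain Y where Y: "Y \<in> carrier_mat k t" "A * Y = 1\<^sub>m t"
    using exists_mat_mult_eq[OF A one_carrier_mat] by blast
  \<comment> \<open>Applied to any \<open>x\<close>, both sides have the same image under the
    injective \<open>\<phi>\<close>, because \<open>A Y A = A\<close>.\<close>
  have "P * (Y * A) = P"
  proof (rule mat_eq_iff_mult_vec[of _ n k])
    fix x :: "'a vec" assume x: "x \<in> carrier_vec k"
    have "P *\<^sub>v (Y *\<^sub>v (A *\<^sub>v x)) = P *\<^sub>v x"
    proof (rule inj_onD[OF bij_betw_imp_inj_on[OF bij]])
      have "A *\<^sub>v (Y *\<^sub>v (A *\<^sub>v x)) = (A * Y) *\<^sub>v (A *\<^sub>v x)" using A Y(1) x by simp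
      then have "A *\<^sub>v (Y *\<^sub>v (A *\<^sub>v x)) = A *\<^sub>v x" using A Y(2) x by simp
      then show "\<phi> (P *\<^sub>v (Y *\<^sub>v (A *\<^sub>v x))) = \<phi> (P *\<^sub>v x)" using \<phi> A Y(1) x by simp
    qed (use A Y x in \<open>auto simp: C\<close>)
    then show "P * (Y * A) *\<^sub>v x = P *\<^sub>v x"
      using assoc_mult_mat_vec[OF P mult_carrier_mat[OF Y(1) A] x] assoc_mult_mat_vec[OF Y(1) A x]
      by simp
  qed (use P A Y in auto)
  then have rel: "transpose_mat G * (Y * A - 1\<^sub>m k) = 0\<^sub>m n k"
    using mult_minus_distrib_mat[OF P mult_carrier_mat[OF Y(1) A] one_carrier_mat] P
    unfolding P_def by simp
  have "Y * A - 1\<^sub>m k \<in> carrier_mat (dim_row G) k"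
    unfolding k_def[symmetric] by (intro minus_carrier_mat one_carrier_mat)
  from generator_matrix_relation[OF gen this rel]
  have "(Y * A - 1\<^sub>m k) $$ (i, j) \<in> nonunits" if "i < k" "j < k" for i j
    using that unfolding k_def by blast
  then have "inj_on ((*\<^sub>v) (Y * A)) (carrier_vec k)"
    using A Y(1) by (intro inj_of_minus_one_nonunits) auto
  then have inj: "inj_on ((*\<^sub>v) A) (carrier_vec k)"
    by (rule inj_on_mult_left_imp[OF A Y(1)])
  show ?thesis
    unfolding P_def[symmetric] k_def[symmetric]
  proof (rule inj_onI)
    fix x y assume "x \<in> carrier_vec k" "y \<in> carrier_vec k" "P *\<^sub>v x = P *\<^sub>v y"
    then have "A *\<^sub>v x = A *\<^sub>v y" using \<phi> by metis
    then show "x = y" using inj \<open>x \<in> carrier_vec k\<close> \<open>y \<in> carrier_vec k\<close> by (simp add: inj_on_eq_iff)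
  qed
qed

end

section \<open>Self-injectivity and left inverses of matrices\<close>

text \<open>The test modules in \<^const>\<open>right_injective\<close> have elements of type \<^typ>\<open>nat \<Rightarrow> 'a\<close>.\<close>

definition vec_to_fun :: "'a::zero vec \<Rightarrow> nat \<Rightarrow> 'a" where
  "vec_to_fun v i = (if i < dim_vec v then v $ i else 0)"

definition fun_module :: "'a::ring_1 vec set \<Rightarrow> ('a, nat \<Rightarrow> 'a) module" where
  "fun_module N = \<lparr>carrier = vec_to_fun ` N, monoid.mult = undefined, one = undefined,
     zero = (\<lambda>_. 0), add = (\<lambda>f g i. f i + g i), module.smult = (\<lambda>r f i. f i * r)\<rparr>"

lemma vec_to_fun_inverse: "v \<in> carrier_vec n \<Longrightarrow> vec n (vec_to_fun v) = v"
  by (auto simp: vec_to_fun_def)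

lemma vec_to_fun_add:
  "x \<in> carrier_vec n \<Longrightarrow> y \<in> carrier_vec n \<Longrightarrow>
    (\<lambda>i. vec_to_fun x i + vec_to_fun y i) = vec_to_fun (x + y :: 'a::ring_1 vec)"
  by (auto simp: vec_to_fun_def)

lemma vec_to_fun_scale:
  "(\<lambda>i. vec_to_fun x i * r) = vec_to_fun (map_vec (\<lambda>a. a * r) (x :: 'a::ring_1 vec))"
  by (auto simp: vec_to_fun_def)

lemma vec_to_fun_zero: "vec_to_fun (0\<^sub>v n) = (\<lambda>_. 0)"
  by (auto simp: vec_to_fun_def)

lemma right_module_fun_module:
  fixes N :: "'a::ring_1 vec set"
  assumes "submodule N ring_of_type_algebra (right_action.vec_module n)"
  shows "right_module ring_of_type_algebra (fun_module N)"
proof -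
  have N: "N \<subseteq> carrier_vec n" "0\<^sub>v n \<in> N" "\<And>x y. x \<in> N \<Longrightarrow> y \<in> N \<Longrightarrow> x + y \<in> N"
    "\<And>r x. x \<in> N \<Longrightarrow> map_vec (\<lambda>a. a * r) x \<in> N"
    using assms by (auto simp: right_action.submodule_vec_module_iff)
  have add: "(\<lambda>i. f i + g i) \<in> vec_to_fun ` N" if fg: "f \<in> vec_to_fun ` N" "g \<in> vec_to_fun ` N" for f g
  proof -
    obtain x y where xy: "x \<in> N" "y \<in> N" "f = vec_to_fun x" "g = vec_to_fun y"
      using fg by blast
    then have "(\<lambda>i. f i + g i) = vec_to_fun (x + y)"
      using vec_to_fun_add[of x n y] N(1) by blast
    then show ?thesis using N(3) xy by blast
  qed
  have scale: "(\<lambda>i. f i * r) \<in> vec_to_fun ` N" if "f \<in> vec_to_fun ` N" for f r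
    using that N(4) vec_to_fun_scale by blast
  have "abelian_group (fun_module N)"
  proof (rule abelian_groupI)
    fix f assume "f \<in> carrier (fun_module N)"
    then show "\<exists>g\<in>carrier (fun_module N). g \<oplus>\<^bsub>fun_module N\<^esub> f = \<zero>\<^bsub>fun_module N\<^esub>"
      using scale[of f "- 1"] by (intro bexI[of _ "\<lambda>i. f i * - 1"]) (auto simp: fun_module_def)
  next
    show "\<zero>\<^bsub>fun_module N\<^esub> \<in> carrier (fun_module N)"
      using imageI[OF N(2), of vec_to_fun] by (simp add: fun_module_def vec_to_fun_zero)
  qed (use add in \<open>auto simp: fun_module_def algebra_simps\<close>)
  then show ?thesis
    using scale
    by (intro right_module.intro right_module_axioms.intro ring_ring_of_type_algebra)
       (auto simp: fun_module_def algebra_simps)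
qed

lemma module_homs_fun_module_iff:
  fixes N :: "'a::ring_1 vec set"
  assumes N: "N \<subseteq> carrier_vec n"
  shows "f \<in> module_homs ring_of_type_algebra (fun_module N) (right_regular ring_of_type_algebra) \<longleftrightarrow>
    (\<forall>x\<in>N. \<forall>y\<in>N. f (vec_to_fun (x + y)) = f (vec_to_fun x) + f (vec_to_fun y)) \<and>
    (\<forall>r. \<forall>x\<in>N. f (vec_to_fun (map_vec (\<lambda>a. a * r) x)) = f (vec_to_fun x) * r)"
proof -
  have "(\<lambda>i. vec_to_fun x i + vec_to_fun y i) = vec_to_fun (x + y)" if "x \<in> N" "y \<in> N" for x y
    using N that vec_to_fun_add by blast
  then show ?thesis
    by (auto simp: module_homs_def fun_module_def right_regular_def vec_to_fun_scale)
qed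

text \<open>Self-injectivity extends the coordinate functions from the column space of \<open>P\<close> to all of
  \<open>R\<^sup>n\<close>, where they are given by rows.\<close>

lemma right_injective_imp_left_inverse:
  fixes P :: "'a::ring_1 mat"
  assumes inj_ring: "right_injective (ring_of_type_algebra :: 'a ring) (right_regular ring_of_type_algebra)"
    and P: "P \<in> carrier_mat n k" and inj: "inj_on ((*\<^sub>v) P) (carrier_vec k)"
  obtains L where "L \<in> carrier_mat k n" "L * P = 1\<^sub>m k"
proof -
  let ?N = "(*\<^sub>v) P ` carrier_vec k" and ?V = "carrier_vec n :: 'a vec set"
  let ?homs = "\<lambda>N. module_homs (ring_of_type_algebra :: 'a ring) (fun_module N)
    (right_regular ring_of_type_algebra)"
  have scale: "map_vec (\<lambda>a. a * r) (P *\<^sub>v x) = P *\<^sub>v map_vec (\<lambda>a. a * r) x"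
    if "x \<in> carrier_vec k" for r x
    using that P by (auto simp: scalar_prod_def sum_distrib_right mult.assoc)
  have add: "P *\<^sub>v x + P *\<^sub>v y = P *\<^sub>v (x + y)" if "x \<in> carrier_vec k" "y \<in> carrier_vec k" for x y
    using mult_add_distrib_mat_vec[OF P that] by simp
  have "0\<^sub>v n = P *\<^sub>v 0\<^sub>v k" using P by auto
  then have "0\<^sub>v n \<in> ?N" by (rule image_eqI) simp
  then have subN: "submodule ?N ring_of_type_algebra (right_action.vec_module n)"
    unfolding right_action.submodule_vec_module_iff using P by (auto simp: scale add)
  have subV: "submodule ?V ring_of_type_algebra (right_action.vec_module n)"
    unfolding right_action.submodule_vec_module_iff by auto
  have NV: "?N \<subseteq> ?V" using P by auto
  \<comment> \<open>The inclusion of the column space of \<open>P\<close> into the whole space is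
    the monomorphism along which to extend.\<close>
  have id: "(\<lambda>f. f) \<in> module_homs ring_of_type_algebra (fun_module ?N) (fun_module ?V)"
    using NV by (auto simp: module_homs_def fun_module_def)
  have "\<exists>g. g \<in> ?homs ?V \<and> (\<forall>x\<in>carrier_vec k. g (vec_to_fun (P *\<^sub>v x)) = x $ j)" if j: "j < k" for j
  proof -
    \<comment> \<open>On the column space this reads off coordinate \<open>j\<close> of the unique
      preimage under \<open>P\<close>.\<close>
    define f where "f h = the_inv_into (carrier_vec k) ((*\<^sub>v) P) (vec n h) $ j" for h
    have f: "f (vec_to_fun (P *\<^sub>v x)) = x $ j" if "x \<in> carrier_vec k" for x
      using that P inj by (simp add: f_def vec_to_fun_inverse the_inv_into_f_f)
    have fN: "f \<in> ?homs ?N"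
      unfolding module_homs_fun_module_iff[OF NV] using j by (auto simp: add scale f)
    obtain g where "g \<in> ?homs ?V" "\<forall>h\<in>carrier (fun_module ?N). g h = f h"
      using inj_ring[unfolded right_injective_def, rule_format, OF right_module_fun_module[OF subN]
          right_module_fun_module[OF subV] id inj_on_id2 fN]
      by blast
    then show ?thesis using f by (intro exI[of _ g]) (auto simp: fun_module_def)
  qed
  then obtain g where g: "\<And>j. j < k \<Longrightarrow> g j \<in> ?homs ?V"
    "\<And>j x. j < k \<Longrightarrow> x \<in> carrier_vec k \<Longrightarrow> g j (vec_to_fun (P *\<^sub>v x)) = x $ j"
    by metis
  have g_sum: "g j (vec_to_fun v) = (\<Sum>i<n. g j (vec_to_fun (unit_vec n i)) * v $ i)"
    if j: "j < k" and v: "v \<in> carrier_vec n" for j v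
  proof -
    \<comment> \<open>Viewing scalars as vectors of length 1 makes
      \<open>right_action.linear_combination\<close> applicable to the functional
      \<open>g j\<close>.\<close>
    let ?F = "\<lambda>v. vec 1 (\<lambda>_. g j (vec_to_fun v))"
    have "?F \<in> module_homs ring_of_type_algebra ((right_action.vec_module n)\<lparr>carrier := ?V\<rparr>)
        (right_action.vec_module 1)"
      using g(1)[OF j] unfolding module_homs_fun_module_iff[OF subset_refl]
      by (auto simp: module_homs_def)
    from right_action.linear_combination[OF subV this, of "{..<n}" "rows (1\<^sub>m n)" "\<lambda>i. v $ i"]
    have "?F (right_action.combination n (rows (1\<^sub>m n)) (\<lambda>i. v $ i) {..<n})
        = vec 1 (\<lambda>l. \<Sum>i<n. ?F (rows (1\<^sub>m n) ! i) $ l * v $ i)"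
      by simp
    also have "\<dots> = vec 1 (\<lambda>_. \<Sum>i<n. g j (vec_to_fun (unit_vec n i)) * v $ i)"
      by (rule eq_vecI) (auto intro!: sum.cong)
    finally have F: "?F (right_action.combination n (rows (1\<^sub>m n)) (\<lambda>i. v $ i) {..<n})
        = vec 1 (\<lambda>_. \<Sum>i<n. g j (vec_to_fun (unit_vec n i)) * v $ i)" .
    have "vec n (\<lambda>i. v $ i) = v" using v by auto
    then have "right_action.combination n (rows (1\<^sub>m n)) (\<lambda>i. v $ i) {..<n} = v"
      using right_action_combination[of "1\<^sub>m n" n n "\<lambda>i. v $ i"] v by (simp add: transpose_one)
    then show ?thesis using arg_cong[OF F, of "\<lambda>w. w $ 0"] by simp
  qed
  \<comment> \<open>Row \<open>j\<close> lists the values of the extended coordinate function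
    \<open>g j\<close> at the unit vectors.\<close>
  define L where "L = mat k n (\<lambda>(j, i). g j (vec_to_fun (unit_vec n i)))"
  have L: "L \<in> carrier_mat k n" by (simp add: L_def)
  have "(L * P) *\<^sub>v x = 1\<^sub>m k *\<^sub>v x" if x: "x \<in> carrier_vec k" for x
  proof -
    have Px: "P *\<^sub>v x \<in> carrier_vec n" using P x by auto
    have "(L *\<^sub>v (P *\<^sub>v x)) $ j = x $ j" if j: "j < k" for j
    proof -
      have "(L *\<^sub>v (P *\<^sub>v x)) $ j = (\<Sum>i<n. g j (vec_to_fun (unit_vec n i)) * (P *\<^sub>v x) $ i)"
        using j Px P by (simp add: L_def scalar_prod_def atLeast0LessThan)
      also have "\<dots> = x $ j"
        using g_sum[OF j Px] g(2)[OF j x] by simp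
      finally show ?thesis .
    qed
    then have "L *\<^sub>v (P *\<^sub>v x) = x" using L x by (intro eq_vecI) auto
    then show ?thesis using L P x by simp
  qed
  then have "L * P = 1\<^sub>m k"
    using L P by (intro mat_eq_iff_mult_vec[of _ k k]) auto
  then show thesis using that L by blast
qed

section \<open>Parity check matrices and complementary pairs\<close>

text \<open>The value is entry \<open>i\<close> of \<open>(E P) x\<close>; this places the rows of
  the idempotent \<open>1 - P L\<close> in the dual code.\<close>

lemma scalar_prod_mult_mat_vec_row:
  fixes E :: "'a::ring_1 mat"
  assumes "E \<in> carrier_mat n n" "P \<in> carrier_mat n k" "E * P = 0\<^sub>m n k"
    and "x \<in> carrier_vec k" "i < n"
  shows "row E i \<bullet> (P *\<^sub>v x) = 0"
proof -
  have "row E i \<bullet> (P *\<^sub>v x) = (E *\<^sub>v (P *\<^sub>v x)) $ i"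
    using assms(1,5) by simp
  also have "E *\<^sub>v (P *\<^sub>v x) = (E * P) *\<^sub>v x"
    using assoc_mult_mat_vec[OF assms(1,2,4)] by simp
  also have "((E * P) *\<^sub>v x) $ i = 0"
    using assms by (simp add: assms(3) scalar_prod_left_zero)
  finally show ?thesis .
qed

context finite_local_ring
begin

text \<open>With \<open>L P = 1\<close> the dual code is the row space of the idempotent \<open>1 - P L = B H\<close>, and the
  idempotent \<open>H B\<close>, which is the identity modulo the radical, is the identity.\<close>

lemma parity_check_matrix_of_complemented:
  fixes C :: "'a vec set"
  assumes C: "C = (*\<^sub>v) P ` carrier_vec k" and P: "P \<in> carrier_mat n k"
    and L: "L \<in> carrier_mat k n" and LP: "L * P = 1\<^sub>m k"
    and par: "parity_check_matrix n C H"
  shows "x \<in> carrier_vec n \<Longrightarrow> H *\<^sub>v x = 0\<^sub>v (dim_row H) \<longleftrightarrow> x \<in> C"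
    and "dim_row H + k = n"
proof -
  define m where "m = dim_row H"
  have H: "H \<in> carrier_mat m n" unfolding m_def by (rule parity_check_matrixD(1)[OF par])
  define E where "E = 1\<^sub>m n - P * L"
  have PL: "P * L \<in> carrier_mat n n" using P L by simp
  have E: "E \<in> carrier_mat n n" unfolding E_def by (rule minus_carrier_mat[OF PL])
  have EP: "E * P = 0\<^sub>m n k"
    unfolding E_def minus_mult_distrib_mat[OF one_carrier_mat PL P]
    using assoc_mult_mat[OF P L P] P by (simp add: LP)
  have LE: "L * E = 0\<^sub>m k n"
    unfolding E_def mult_minus_distrib_mat[OF L one_carrier_mat PL]
    using assoc_mult_mat[OF L P L, symmetric] L by (simp add: LP)
  have split: "E *\<^sub>v x + P *\<^sub>v (L *\<^sub>v x) = x" if x: "x \<in> carrier_vec n" for x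
  proof -
    have "E *\<^sub>v x = x - P *\<^sub>v (L *\<^sub>v x)"
      unfolding E_def minus_mult_distrib_mat_vec[OF one_carrier_mat PL x]
      using assoc_mult_mat_vec[OF P L x] x by simp
    then show ?thesis using x P L by (intro eq_vecI) simp_all
  qed
  have "row H i \<in> dual_code n C" if "i < m" for i
  proof -
    have "row H i \<in> set (rows H)" using that H by (auto simp: rows_def)
    then show ?thesis using parity_check_matrix_rows(2)[OF par] by blast
  qed
  then have Hdual: "row H i \<bullet> (P *\<^sub>v x) = 0" if "i < m" "x \<in> carrier_vec k" for i x
    using that by (auto simp: dual_code_def C)
  have HPx: "H *\<^sub>v (P *\<^sub>v x) = 0\<^sub>v m" if "x \<in> carrier_vec k" for x
    using Hdual that H by (intro eq_vecI) simp_all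
  have HP: "H * P = 0\<^sub>m m k"
  proof (rule mat_eq_iff_mult_vec[of _ m k])
    fix x :: "'a vec" assume x: "x \<in> carrier_vec k"
    show "H * P *\<^sub>v x = 0\<^sub>m m k *\<^sub>v x"
      unfolding assoc_mult_mat_vec[OF H P x] HPx[OF x] using x by (intro eq_vecI) simp_all
  qed (use H P in auto)
  have "row E i \<in> dual_code n C" if "i < n" for i
    using scalar_prod_mult_mat_vec_row[OF E P EP] that E by (auto simp: dual_code_def C)
  then have "\<exists>c. row E i = vec n (\<lambda>j. vec m c \<bullet> col H j)" if "i < n" for i
    using that unfolding parity_check_matrix_rows(1)[OF par] m_def by blast
  then obtain b where b: "\<And>i. i < n \<Longrightarrow> row E i = vec n (\<lambda>j. vec m (b i) \<bullet> col H j)"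
    by metis
  \<comment> \<open>Row \<open>i\<close> holds coefficients that express row \<open>i\<close> of
    \<open>E\<close>, a dual vector, through the rows of \<open>H\<close>.\<close>
  define B where "B = mat n m (\<lambda>(i, j). b i j)"
  have B: "B \<in> carrier_mat n m" by (simp add: B_def)
  have BH: "B * H = E"
  proof (rule eq_matI)
    fix i j assume "i < dim_row E" "j < dim_col E"
    then have ij: "i < n" "j < n" using E by auto
    have "row B i = vec m (b i)" using ij by (intro eq_vecI) (simp_all add: B_def)
    then have "(B * H) $$ (i, j) = vec m (b i) \<bullet> col H j" using ij B H by simp
    also have "\<dots> = row E i $ j" unfolding b[OF ij(1)] using ij by simp
    also have "\<dots> = E $$ (i, j)" using ij E by simp
    finally show "(B * H) $$ (i, j) = E $$ (i, j)" .
  qed (use B H E in auto)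
  have "H * (P * L) = 0\<^sub>m m n"
    using assoc_mult_mat[OF H P L, symmetric] L by (simp add: HP)
  then have HE: "H * E = H"
    unfolding E_def mult_minus_distrib_mat[OF H one_carrier_mat PL]
    using H by (intro eq_matI) simp_all
  have HB: "H * B \<in> carrier_mat m m" using H B by simp
  have HBH: "H * B * H = H"
    using assoc_mult_mat[OF H B H] BH HE by simp
  \<comment> \<open>The rows of \<open>H B - 1\<close> are relations between the minimal generators
    of the dual code.\<close>
  have rel: "(H * B - 1\<^sub>m m) * H = 0\<^sub>m m n"
    unfolding minus_mult_distrib_mat[OF HB one_carrier_mat H] HBH using H by simp
  have "H * B - 1\<^sub>m m \<in> carrier_mat m (dim_row H)"
    unfolding m_def[symmetric] by (intro minus_carrier_mat one_carrier_mat)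
  from parity_check_matrix_relation[OF par this rel]
  have "(H * B - 1\<^sub>m m) $$ (i, j) \<in> nonunits" if "i < m" "j < m" for i j
    using that unfolding m_def by blast
  then have inj: "inj_on ((*\<^sub>v) (H * B)) (carrier_vec m)"
    by (intro inj_of_minus_one_nonunits[OF HB]) blast
  \<comment> \<open>\<open>H B\<close> is idempotent and injective, so one factor cancels.\<close>
  have HBx: "H *\<^sub>v (B *\<^sub>v x) = x" if x: "x \<in> carrier_vec m" for x
  proof -
    have "H * B *\<^sub>v (H * B *\<^sub>v x) = (H * B * H) *\<^sub>v (B *\<^sub>v x)"
      using assoc_mult_mat_vec[OF HB H mult_mat_vec_carrier[OF B x]] assoc_mult_mat_vec[OF H B x]
      by simp
    also have "\<dots> = H * B *\<^sub>v x" unfolding HBH using assoc_mult_mat_vec[OF H B x] by simp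
    finally have "H * B *\<^sub>v x = x"
      using inj_onD[OF inj _ mult_mat_vec_carrier[OF HB x] x] by blast
    then show ?thesis using assoc_mult_mat_vec[OF H B x] by simp
  qed
  have LBx: "L *\<^sub>v (B *\<^sub>v x) = 0\<^sub>v k" if x: "x \<in> carrier_vec m" for x
  proof -
    have Bx: "B *\<^sub>v x \<in> carrier_vec n" by (rule mult_mat_vec_carrier[OF B x])
    \<comment> \<open>\<open>E B = B H B = B\<close>, and \<open>L\<close> annihilates the image of
      \<open>E\<close>.\<close>
    have "B *\<^sub>v x = E *\<^sub>v (B *\<^sub>v x)"
      unfolding BH[symmetric] assoc_mult_mat_vec[OF B H Bx] HBx[OF x] ..
    then have "L *\<^sub>v (B *\<^sub>v x) = L * E *\<^sub>v (B *\<^sub>v x)"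
      using assoc_mult_mat_vec[OF L E Bx] by simp
    also have "\<dots> = 0\<^sub>v k" unfolding LE using Bx by (intro eq_vecI) simp_all
    finally show ?thesis .
  qed
  have LPx: "L *\<^sub>v (P *\<^sub>v x) = x" if x: "x \<in> carrier_vec k" for x
    using assoc_mult_mat_vec[OF L P x] x by (simp add: LP)
  have Ex: "E *\<^sub>v x = B *\<^sub>v (H *\<^sub>v x)" if x: "x \<in> carrier_vec n" for x
    unfolding BH[symmetric] by (rule assoc_mult_mat_vec[OF B H x])

  show "H *\<^sub>v x = 0\<^sub>v (dim_row H) \<longleftrightarrow> x \<in> C" if x: "x \<in> carrier_vec n" for x
  proof
    assume "H *\<^sub>v x = 0\<^sub>v (dim_row H)"
    then have "E *\<^sub>v x = 0\<^sub>v n" unfolding Ex[OF x] m_def[symmetric] using B by auto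
    then have "x = P *\<^sub>v (L *\<^sub>v x)" using split[OF x] P L x by simp
    then show "x \<in> C" unfolding C using mult_mat_vec_carrier[OF L x] by blast
  next
    assume "x \<in> C"
    then show "H *\<^sub>v x = 0\<^sub>v (dim_row H)" using HPx by (auto simp: C m_def)
  qed

  \<comment> \<open>\<open>H\<close> and \<open>L\<close> together are coordinates on the whole
    space, with inverse given by \<open>B\<close> and \<open>P\<close>; comparing cardinalities
    yields the rank formula.\<close>
  have "bij_betw (\<lambda>x. (H *\<^sub>v x, L *\<^sub>v x)) (carrier_vec n) (carrier_vec m \<times> carrier_vec k)"
  proof (rule bij_betwI[of _ _ _ "\<lambda>(a, c). B *\<^sub>v a + P *\<^sub>v c"])
    fix x :: "'a vec" assume x: "x \<in> carrier_vec n"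
    show "(case (H *\<^sub>v x, L *\<^sub>v x) of (a, c) \<Rightarrow> B *\<^sub>v a + P *\<^sub>v c) = x"
      using split[OF x] by (simp add: Ex[OF x])
  next
    fix y :: "'a vec \<times> 'a vec" assume "y \<in> carrier_vec m \<times> carrier_vec k"
    then obtain a c where y: "y = (a, c)" and a: "a \<in> carrier_vec m" and c: "c \<in> carrier_vec k"
      by blast
    have Ba: "B *\<^sub>v a \<in> carrier_vec n" and Pc: "P *\<^sub>v c \<in> carrier_vec n"
      using B a P c by auto
    have "H *\<^sub>v (B *\<^sub>v a + P *\<^sub>v c) = a"
      using a by (simp add: mult_add_distrib_mat_vec[OF H Ba Pc] HBx[OF a] HPx[OF c])
    moreover have "L *\<^sub>v (B *\<^sub>v a + P *\<^sub>v c) = c"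
      using c by (simp add: mult_add_distrib_mat_vec[OF L Ba Pc] LBx[OF a] LPx[OF c])
    ultimately show "(\<lambda>x. (H *\<^sub>v x, L *\<^sub>v x)) (case y of (a, c) \<Rightarrow> B *\<^sub>v a + P *\<^sub>v c) = y"
      by (simp add: y)
  qed (use H L B P in auto)
  then have "card (carrier_vec n :: 'a vec set)
      = card ((carrier_vec m :: 'a vec set) \<times> (carrier_vec k :: 'a vec set))"
    by (rule bij_betw_same_card)
  then have "card (UNIV :: 'a set) ^ n = card (UNIV :: 'a set) ^ (m + k)"
    by (simp add: card_carrier_vec card_cartesian_product power_add)
  then show "dim_row H + k = n"
    using card_UNIV_ge_2[where 'a = 'a] power_inject_exp[of "card (UNIV :: 'a set)" n "m + k"]
    by (simp add: m_def)
qed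

end

text \<open>A trivial intersection makes addition injective on \<open>C \<times> D\<close>, and by
  the cardinality hypothesis an injective sum map fills the whole space.\<close>

lemma LCP_iff_Int:
  fixes C D :: "'a::{finite, ring_1} vec set"
  assumes C: "linear_code n C" and D: "linear_code n D"
    and card: "card C * card D = card (carrier_vec n :: 'a vec set)"
  shows "LCP n C D \<longleftrightarrow> C \<inter> D = {0\<^sub>v n}"
proof
  assume Int: "C \<inter> D = {0\<^sub>v n}"
  have sub: "C \<subseteq> carrier_vec n" "D \<subseteq> carrier_vec n"
    using C D by (auto simp: linear_code_def right_action_vec_module[symmetric]
        right_action.submodule_vec_module_iff)
  have diff: "x - y \<in> K" if K: "linear_code n K" and xy: "x \<in> K" "y \<in> K" for K and x y :: "'a vec"
  proof -
    have cl: "K \<subseteq> carrier_vec n" "\<forall>x\<in>K. \<forall>y\<in>K. x + y \<in> K" "\<forall>r. \<forall>x\<in>K. map_vec (\<lambda>a. a * r) x \<in> K"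
      using K by (auto simp: linear_code_def right_action_vec_module[symmetric]
        right_action.submodule_vec_module_iff)
    have "x \<in> carrier_vec n" "y \<in> carrier_vec n" using cl(1) xy by auto
    then have "x - y = x + map_vec (\<lambda>a. a * - 1) y" by (intro eq_vecI) simp_all
    then show ?thesis using cl(2,3) xy by metis
  qed
  have "inj_on (\<lambda>(c, d). c + d) (C \<times> D)"
  proof (rule inj_onI, clarify)
    fix c d c' d' assume cd: "c \<in> C" "d \<in> D" "c' \<in> C" "d' \<in> D" and eq: "c + d = c' + d'"
    have car: "c \<in> carrier_vec n" "d \<in> carrier_vec n" "c' \<in> carrier_vec n" "d' \<in> carrier_vec n"
      using cd sub by auto
    have comp: "c $ i + d $ i = c' $ i + d' $ i" if "i < n" for i
      using arg_cong[OF eq, of "\<lambda>v. v $ i"] car that by simp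
    \<comment> \<open>The common difference lies in both codes and must vanish.\<close>
    then have "c - c' = d' - d"
      using car by (intro eq_vecI) (simp_all add: algebra_simps)
    then have "c - c' \<in> C \<inter> D"
      using diff[OF C cd(1,3)] diff[OF D cd(4,2)] by simp
    then have 0: "c - c' = 0\<^sub>v n" using Int by simp
    have "c $ i = c' $ i" if "i < n" for i
      using arg_cong[OF 0, of "\<lambda>v. v $ i"] car that by simp
    then have "c = c'" using car by (intro eq_vecI) simp_all
    moreover have "d $ i = d' $ i" if "i < n" for i
      using comp[OF that] \<open>c = c'\<close> by simp
    then have "d = d'" using car by (intro eq_vecI) simp_all
    ultimately show "c = c' \<and> d = d'" by simp
  qed
  then have "card ((\<lambda>(c, d). c + d) ` (C \<times> D)) = card (carrier_vec n :: 'a vec set)"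
    by (simp add: card_image card_cartesian_product card)
  moreover have "(\<lambda>(c, d). c + d) ` (C \<times> D) \<subseteq> carrier_vec n"
    using sub by (auto intro!: add_carrier_vec)
  ultimately have "(\<lambda>(c, d). c + d) ` (C \<times> D) = carrier_vec n"
    by (intro card_subset_eq finite_carrier_vec)
  moreover have "(\<lambda>(c, d). c + d) ` (C \<times> D) = {c + d | c d. c \<in> C \<and> d \<in> D}"
    by auto
  ultimately show "LCP n C D" using Int by (simp add: LCP_def)
qed (simp add: LCP_def)

context finite_local_ring
begin

text \<open>Since \<open>D\<close> is the kernel of \<open>H2\<close> and \<open>P\<close> is
  injective with image \<open>C\<close>, the kernel of \<open>H2 P\<close> corresponds to
  \<open>C \<inter> D\<close>. Counting makes this matrix square, so a trivial kernel means
  invertibility.\<close>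

lemma LCP_iff_invertible:
  fixes C D :: "'a vec set"
  assumes inj_ring: "right_injective (ring_of_type_algebra :: 'a ring) (right_regular ring_of_type_algebra)"
    and C: "free_linear_code n C" "generator_matrix n C G1"
    and D: "free_linear_code n D" "generator_matrix n D G2" "parity_check_matrix n D H2"
    and card: "card C * card D = card (carrier_vec n :: 'a vec set)"
  shows "LCP n C D \<longleftrightarrow> invertible_over_ring (H2 * transpose_mat G1)"
proof -
  define k where "k = dim_row G1"
  define P where "P = transpose_mat G1"
  define k2 where "k2 = dim_row G2"
  define Q where "Q = transpose_mat G2"
  have P: "P \<in> carrier_mat n k"
    unfolding P_def k_def transpose_carrier_mat by (rule generator_matrixD(1)[OF C(2)])
  have Q: "Q \<in> carrier_mat n k2"
    unfolding Q_def k2_def transpose_carrier_mat by (rule generator_matrixD(1)[OF D(2)])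
  have C_eq: "C = (*\<^sub>v) P ` carrier_vec k" and D_eq: "D = (*\<^sub>v) Q ` carrier_vec k2"
    using generator_matrix_image[OF C(2)] generator_matrix_image[OF D(2)]
    by (simp_all add: P_def k_def Q_def k2_def)
  have injP: "inj_on ((*\<^sub>v) P) (carrier_vec k)" and injQ: "inj_on ((*\<^sub>v) Q) (carrier_vec k2)"
    using free_code_generator_inj[OF C] free_code_generator_inj[OF D(1,2)]
    by (simp_all add: P_def k_def Q_def k2_def)
  obtain L where L: "L \<in> carrier_mat k2 n" "L * Q = 1\<^sub>m k2"
    using right_injective_imp_left_inverse[OF inj_ring Q injQ] .
  note H2 = parity_check_matrix_of_complemented[OF D_eq Q L D(3)]
  \<comment> \<open>The cardinality hypothesis becomes \<open>k + k2 = n\<close>, while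
    \<open>H2\<close> has \<open>n - k2\<close> rows; hence \<open>H2 * P\<close> is a
    \<open>k\<close> by \<open>k\<close> matrix.\<close>
  have "card C = card (UNIV :: 'a set) ^ k" "card D = card (UNIV :: 'a set) ^ k2"
    unfolding C_eq D_eq by (simp_all add: card_image injP injQ card_carrier_vec)
  then have "card (UNIV :: 'a set) ^ (k + k2) = card (UNIV :: 'a set) ^ n"
    using card by (simp add: card_carrier_vec power_add)
  then have "k + k2 = n"
    using card_UNIV_ge_2[where 'a = 'a] power_inject_exp[of "card (UNIV :: 'a set)" "k + k2" n]
    by simp
  then have dim: "dim_row H2 = k" using H2(2) by simp
  have H: "H2 \<in> carrier_mat k n" using parity_check_matrixD(1)[OF D(3)] unfolding dim .
  have HP: "H2 * P \<in> carrier_mat k k" using H P by simp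
  have mem_D: "P *\<^sub>v x \<in> D \<longleftrightarrow> H2 * P *\<^sub>v x = 0\<^sub>v k" if x: "x \<in> carrier_vec k" for x
    using H2(1)[OF mult_mat_vec_carrier[OF P x]] dim
    by (simp add: assoc_mult_mat_vec[OF H P x])
  have kerP: "P *\<^sub>v x = 0\<^sub>v n \<longleftrightarrow> x = 0\<^sub>v k" if "x \<in> carrier_vec k" for x
  proof
    show "P *\<^sub>v x = 0\<^sub>v n \<Longrightarrow> x = 0\<^sub>v k"
      using injP that unfolding inj_on_mult_mat_vec_iff[OF P] by blast
    show "x = 0\<^sub>v k \<Longrightarrow> P *\<^sub>v x = 0\<^sub>v n" using P by auto
  qed
  have lin: "linear_code n C" "linear_code n D"
    using C(1) D(1) by (simp_all add: free_linear_code_def)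
  then have "0\<^sub>v n \<in> C \<inter> D"
    by (simp add: linear_code_def right_action_vec_module[symmetric] right_action.submodule_vec_module_iff)
  then have "C \<inter> D = {0\<^sub>v n} \<longleftrightarrow> (\<forall>y\<in>C. y \<in> D \<longrightarrow> y = 0\<^sub>v n)" by blast
  also have "\<dots> \<longleftrightarrow> (\<forall>x\<in>carrier_vec k. H2 * P *\<^sub>v x = 0\<^sub>v k \<longrightarrow> x = 0\<^sub>v k)"
    unfolding C_eq using mem_D kerP by simp
  also have "\<dots> \<longleftrightarrow> invertible_over_ring (H2 * P)"
    unfolding invertible_over_ring_iff_inj[OF HP] inj_on_mult_mat_vec_iff[OF HP] ..
  finally show ?thesis unfolding LCP_iff_Int[OF lin card] P_def .
qed

end

lemma LCP_commute:
  fixes C D :: "'a::ring_1 vec set"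
  assumes "linear_code n C" "linear_code n D"
  shows "LCP n C D \<longleftrightarrow> LCP n D C"
proof -
  have "C \<subseteq> carrier_vec n" "D \<subseteq> carrier_vec n"
    using assms by (auto simp: linear_code_def right_action_vec_module[symmetric]
        right_action.submodule_vec_module_iff)
  then have "{c + d | c d. c \<in> C \<and> d \<in> D} = {d + c | d c. d \<in> D \<and> c \<in> C}"
    using comm_add_vec by blast
  then show ?thesis by (simp add: LCP_def Int_commute)
qed

text \<open>\<open>LCP_iff_invertible\<close> applies to the pair and to the exchanged pair, so each
  matrix alone is invertible exactly when the pair is complementary, and the disjunction joins two
  equivalent conditions.\<close>

theorem theorem3p9:
  fixes C D :: "'a::{finite, ring_1} vec set"
    and G1 G2 H1 H2 :: "'a mat"
    and n :: nat
  assumes "local_ring (ring_of_type_algebra :: 'a ring)"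
    and "finite_frobenius_ring (ring_of_type_algebra :: 'a ring)"
    and "free_linear_code n C" and "free_linear_code n D"
    and "generator_matrix n C G1" and "generator_matrix n D G2"
    and "parity_check_matrix n C H1" and "parity_check_matrix n D H2"
    and "card C * card D = card (carrier_vec n :: 'a vec set)"
  shows "LCP n C D \<longleftrightarrow>
    invertible_over_ring (H2 * transpose_mat G1) \<or> invertible_over_ring (H1 * transpose_mat G2)"
proof -
  interpret finite_local_ring "TYPE('a)" by unfold_locales (rule assms(1))
  have inj: "right_injective (ring_of_type_algebra :: 'a ring) (right_regular ring_of_type_algebra)"
    using assms(2) by (simp add: finite_frobenius_ring_def)
  have "card D * card C = card (carrier_vec n :: 'a vec set)"
    using assms(9) by (simp add: mult.commute)
  then have "LCP n D C \<longleftrightarrow> invertible_over_ring (H1 * transpose_mat G2)"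
    by (rule LCP_iff_invertible[OF inj assms(4,6,3,5,7)])
  moreover have "LCP n C D \<longleftrightarrow> invertible_over_ring (H2 * transpose_mat G1)"
    by (rule LCP_iff_invertible[OF inj assms(3,5,4,6,8,9)])
  moreover have "LCP n C D \<longleftrightarrow> LCP n D C"
    using assms(3,4) by (intro LCP_commute) (simp_all add: free_linear_code_def)
  ultimately show ?thesis by blast
qed

end
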